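(* Let $p\in(0,1)$ be a constant and let $G=G_p\in\mathcal{G}_{n,p}$ be a random graph. Let $H_A(G)$ be the additively weighted Harary matrix of $G$, with $(i,j)$-entry $\frac{d_i+d_j}{D(i,j)}$ if $i\neq j$ and $0$ if $i=j$, and let $H_M(G)$ be the multiplicatively weighted Harary matrix of $G$, with $(i,j)$-entry $\frac{d_id_j}{D(i,j)}$ if $i\neq j$ and $0$ if $i=j$. Then $$\mathscr{E}(H_A(G))=\Big(\frac{8}{3\pi}p\sqrt{p(1-p)}+o(1)\Big)n^{5/2}\quad\text{a.s.}$$ and $$\mathscr{E}(H_M(G))=\Big(\frac{4}{3\pi}p^{2}\sqrt{p(1-p)}+o(1)\Big)n^{7/2}\quad\text{a.s.}$$
   Context: $d_i$ is the degree of vertex $i$ and $D(i,j)$ is the distance between vertices $i$ and $j$ in $G$. The energy of a real symmetric matrix $M$ with eigenvalues $\lambda_1,\dots,\lambda_n$ is $\mathscr{E}(M)=\sum_{i=1}^n|\lambda_i|$. $\mathcal{G}_{n,p}$ is the Erdős–Rényi random graph model on $n$ vertices, each edge chosen independently with probability $p$. "a.s." means with probability tending to $1$ as $n\to\infty$; the $o(1)$ term is bounded in absolute value by a deterministic sequence tending to $0$ with probability tending to $1$. (With probability tending to $1$ the graph is connected with diameter $2$, so the convention for distances in disconnected graphs is irrelevant.) *)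

theory Defs
  imports
    "HOL-Probability.Probability"
    "HOL-Computational_Algebra.Polynomial"
    "Jordan_Normal_Form.Char_Poly"
begin

text \<open>A graph on the vertex set \<open>{..<n}\<close> is represented by its set of edges, each edge being a
  two-element subset of \<open>{..<n}\<close>.\<close>

type_synonym edge_set = "nat set set"

definition all_edges :: "nat \<Rightarrow> edge_set" where
  "all_edges n = {e. e \<subseteq> {..<n} \<and> card e = 2}"

definition gnp :: "nat \<Rightarrow> real \<Rightarrow> edge_set pmf" where
  "gnp n p =
     map_pmf (\<lambda>f. {e \<in> all_edges n. f e}) (Pi_pmf (all_edges n) False (\<lambda>_. bernoulli_pmf p))"

definition vdegree :: "edge_set \<Rightarrow> nat \<Rightarrow> nat" where
  "vdegree E i = card {e \<in> E. i \<in> e}"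

definition adj :: "edge_set \<Rightarrow> nat rel" where
  "adj E = {(i, j). {i, j} \<in> E}"

text \<open>The length of a shortest walk from \<open>i\<close> to \<open>j\<close>. Vertices in different components get the dummy
  value 0; since \<open>x / 0 = 0\<close>, the corresponding entries of the Harary matrices below are then 0,
  matching the convention \<open>1 / \<infinity> = 0\<close>.\<close>

definition dist_graph :: "edge_set \<Rightarrow> nat \<Rightarrow> nat \<Rightarrow> nat" where
  "dist_graph E i j =
     (if (i, j) \<in> (adj E)\<^sup>* then (LEAST k. (i, j) \<in> adj E ^^ k) else 0)"

definition harary_add :: "nat \<Rightarrow> edge_set \<Rightarrow> real mat" where
  "harary_add n E = mat n n (\<lambda>(i, j).
     if i = j then 0 else (real (vdegree E i) + real (vdegree E j)) / real (dist_graph E i j))"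

definition harary_mult :: "nat \<Rightarrow> edge_set \<Rightarrow> real mat" where
  "harary_mult n E = mat n n (\<lambda>(i, j).
     if i = j then 0 else (real (vdegree E i) * real (vdegree E j)) / real (dist_graph E i j))"

text \<open>The sum of \<open>\<bar>\<lambda>\<bar>\<close> over the eigenvalues, counted with algebraic multiplicity. Only real eigenvalues
  are seen here, so this is the energy for matrices whose spectrum is real, such as the symmetric
  ones.\<close>

definition energy :: "real mat \<Rightarrow> real" where
  "energy M = (\<Sum>x | eigenvalue M x. real (Polynomial.order x (char_poly M)) * \<bar>x\<bar>)"

text \<open>A property of random graphs holds a.s. if its probability tends to 1 as \<open>n \<rightarrow> \<infinity>\<close>.\<close>

definition gnp_as :: "real \<Rightarrow> (nat \<Rightarrow> edge_set \<Rightarrow> bool) \<Rightarrow> bool" where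
  "gnp_as p P \<longleftrightarrow> (\<lambda>n. measure_pmf.prob (gnp n p) {E. P n E}) \<longlonglongrightarrow> 1"

text \<open>\<open>X = (c + o(1)) n\<^sup>a\<close> a.s., where the random error \<open>\<delta>\<close> is dominated by a deterministic null
  sequence \<open>\<epsilon>\<close> with probability tending to 1.\<close>

definition gnp_as_asymp :: "real \<Rightarrow> (nat \<Rightarrow> edge_set \<Rightarrow> real) \<Rightarrow> real \<Rightarrow> real \<Rightarrow> bool" where
  "gnp_as_asymp p X c a \<longleftrightarrow>
     (\<exists>\<epsilon> :: nat \<Rightarrow> real. \<epsilon> \<longlonglongrightarrow> 0 \<and>
        gnp_as p (\<lambda>n E. \<exists>\<delta>. \<bar>\<delta>\<bar> \<le> \<epsilon> n \<and> X n E = (c + \<delta>) * real n powr a))"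

end

theory Submission
  imports Defs "HOL-Real_Asymp.Real_Asymp"
begin

text \<open>
  With high probability every degree is close to \<open>n * p\<close> and almost every pair of vertices is at distance 1 or 2, so
  that \<open>1 / D(i, j)\<close> equals \<open>(1 + a) / 2\<close> where \<open>a\<close> is the entry of the adjacency matrix. Off the diagonal the two Harary
  matrices are therefore close to \<open>\<alpha> * (1 + a)\<close> with \<open>\<alpha> = n * p\<close> in the additive and \<open>\<alpha> = n\<^sup>2 * p\<^sup>2 / 2\<close> in the multiplicative case. This
  is \<open>\<alpha>\<close> times the centred adjacency matrix \<open>W\<close>, plus a multiple of the all-ones matrix, up to the diagonal. For symmetric
  matrices the energy is the trace norm: it satisfies the triangle inequality, is at most \<open>sqrt n\<close> times the Frobenius
  norm, and equals \<open>n\<close> on the all-ones matrix. Hence everything except \<open>\<alpha> * W\<close> contributes a smaller order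
  (\<open>trace_norm_perturbation_avg\<close>). The required degree and codegree estimates are second moment bounds.

  It remains to find the trace norm of \<open>W\<close>, whose spectrum follows the semicircle law. Coulson's formula \<open>\<bar>x\<bar> = 2 / pi * \<integral> x\<^sup>2 / (x\<^sup>2 + t\<^sup>2) dt\<close> over \<open>t > 0\<close> expresses the trace norm
  through resolvent traces on the imaginary axis (\<open>trace_norm_as_integral\<close>). For the mean of these traces, exact
  integration by parts for a Bernoulli variable together with the resolvent identity gives the quadratic equation of
  the semicircle law with an explicit error (\<open>self_consistent_equation\<close>). On the imaginary axis this
  equation is stable for trivial reasons, so dominated convergence gives the limit \<open>8 / (3 * pi) * sqrt (p * (1 - p))\<close>
  of the mean of the trace norm divided by \<open>n powr (3 / 2)\<close> (\<open>trace_norm_wigner_avg_limit\<close>).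

  All fluctuations, of resolvent traces, of degrees, of codegrees and of the trace norm itself, are controlled by one tool,
  the Efron--Stein inequality (\<open>efron_stein\<close>): flipping one edge changes each of these quantities by a bounded
  amount. The outcome is convergence in mean, and Markov's inequality turns it into the asymptotic
  statement (\<open>gnp_as_asymp_of_mean\<close>).
\<close>

section \<open>The spectral theorem for real symmetric matrices\<close>

text \<open>The rows \<open>U k\<close> for \<open>k < n\<close> are the vectors. Matrices are plain functions on pairs of naturals,
  of which only the entries below \<open>n\<close> matter; this lets \<open>n\<close> vary freely within a statement.\<close>

definition orthonormal :: "nat \<Rightarrow> (nat \<Rightarrow> nat \<Rightarrow> real) \<Rightarrow> bool" where
  "orthonormal n U \<longleftrightarrow> (\<forall>k<n. \<forall>l<n. (\<Sum>i<n. U k i * U l i) = of_bool (k = l))"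

definition diagonalizes :: "nat \<Rightarrow> (nat \<Rightarrow> nat \<Rightarrow> real) \<Rightarrow> (nat \<Rightarrow> real) \<Rightarrow> (nat \<Rightarrow> nat \<Rightarrow> real) \<Rightarrow> bool" where
  "diagonalizes n U l M \<longleftrightarrow> orthonormal n U \<and>
     (\<forall>i<n. \<forall>j<n. M i j = (\<Sum>k<n. l k * U k i * U k j))"

definition sym_on :: "nat \<Rightarrow> (nat \<Rightarrow> nat \<Rightarrow> real) \<Rightarrow> bool" where
  "sym_on n M \<longleftrightarrow> (\<forall>i<n. \<forall>j<n. M i j = M j i)"

lemma sum_of_bool_collapse:
  fixes f :: "nat \<Rightarrow> 'a::semiring_1"
  shows "k < n \<Longrightarrow> (\<Sum>i<n. of_bool (i = k) * f i) = f k"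
    and "k < n \<Longrightarrow> (\<Sum>i<n. of_bool (k = i) * f i) = f k"
    and "k < n \<Longrightarrow> (\<Sum>i<n. f i * of_bool (i = k)) = f k"
    and "k < n \<Longrightarrow> (\<Sum>i<n. f i * of_bool (k = i)) = f k"
  by (simp_all add: of_bool_def if_distrib if_distribR cong: if_cong)

text \<open>A one-sided inverse of a square matrix is two-sided, so orthonormal rows force orthonormal
  columns.\<close>

lemma orthonormal_transpose:
  assumes "orthonormal n U"
  shows "orthonormal n (\<lambda>i k. U k i)"
proof -
  define A where "A = mat n n (\<lambda>(i, j). U i j)"
  have A: "A \<in> carrier_mat n n" by (simp add: A_def)
  have *: "A * transpose_mat A = 1\<^sub>m n"
    using assms by (intro eq_matI)
      (auto simp: A_def orthonormal_def scalar_prod_def atLeast0LessThan one_mat_def)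
  have "transpose_mat A * A = 1\<^sub>m n"
    using mat_mult_left_right_inverse[OF A _ *] A by simp
  hence "(transpose_mat A * A) $$ (i, j) = of_bool (i = j)" if "i < n" "j < n" for i j
    using that by (auto simp: one_mat_def)
  thus ?thesis
    by (auto simp: A_def orthonormal_def scalar_prod_def atLeast0LessThan)
qed

lemma orthonormalD:
  assumes "orthonormal n U" "k < n" "l < n"
  shows "(\<Sum>i<n. U k i * U l i) = of_bool (k = l)" "(\<Sum>i<n. U i k * U i l) = of_bool (k = l)"
  using assms(1) orthonormal_transpose[OF assms(1)] assms(2,3) unfolding orthonormal_def by auto

text \<open>Over the complex numbers the characteristic polynomial has a root \<open>z\<close>. For an eigenvector
  \<open>w\<close> of \<open>z\<close>, symmetry of \<open>M\<close> makes \<open>w\<^sup>* M w = z |w|\<^sup>2\<close> real, hence \<open>z\<close> is real; then \<open>z\<close> is also a root over the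
  reals, which yields a real eigenvector.\<close>

lemma real_eigenvector_exists:
  assumes M: "sym_on n M" and n: "n > 0"
  shows "\<exists>v e. (\<Sum>i<n. v i ^ 2) = 1 \<and> (\<forall>i<n. (\<Sum>j<n. M i j * v j) = e * v i)"
proof -
  define A where "A = mat n n (\<lambda>(i, j). M i j)"
  have A: "A \<in> carrier_mat n n" by (simp add: A_def)
  define B where "B = map_mat complex_of_real A"
  have B: "B \<in> carrier_mat n n" by (simp add: B_def A_def)
  from char_poly_factorized[OF B] obtain as where
    as: "char_poly B = (\<Prod>a\<leftarrow>as. [:- a, 1:])" "length as = n" by blast
  define z where "z = hd as"
  have "z \<in> set as" using as n by (cases as) (auto simp: z_def)
  hence "poly (char_poly B) z = 0"
    by (simp add: as(1) poly_prod_list o_def prod_list_zero_iff)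
  hence "eigenvalue B z" using eigenvalue_root_char_poly[OF B] by simp
  then obtain w where w: "w \<in> carrier_vec n" "w \<noteq> 0\<^sub>v n" "B *\<^sub>v w = z \<cdot>\<^sub>v w"
    using B unfolding eigenvalue_def eigenvector_def by auto
  have ev: "(\<Sum>j<n. of_real (M i j) * w $ j) = z * w $ i" if "i < n" for i
  proof -
    have "(B *\<^sub>v w) $ i = (\<Sum>j<n. of_real (M i j) * w $ j)"
      using that w(1) by (simp add: B_def A_def scalar_prod_def atLeast0LessThan)
    thus ?thesis using that w by simp
  qed
  have "\<exists>i<n. w $ i \<noteq> 0"
    using w(1,2) by (metis carrier_vecD eq_vecI index_zero_vec(1,2))
  then obtain i0 where i0: "i0 < n" "w $ i0 \<noteq> 0" by auto
  define N where "N = (\<Sum>i<n. cmod (w $ i) ^ 2)"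
  have N: "N > 0" unfolding N_def
    using i0 by (intro sum_pos2[where i = i0]) auto
  have *: "(\<Sum>i<n. \<Sum>j<n. cnj (w $ i) * (of_real (M i j) * w $ j)) = z * of_real N"
  proof -
    have "(\<Sum>j<n. cnj (w $ i) * (of_real (M i j) * w $ j)) = z * of_real (cmod (w $ i) ^ 2)"
      if "i < n" for i
    proof -
      have "(\<Sum>j<n. cnj (w $ i) * (of_real (M i j) * w $ j)) = cnj (w $ i) * (z * w $ i)"
        using ev[OF that] by (simp flip: sum_distrib_left)
      also have "\<dots> = z * (w $ i * cnj (w $ i))" by simp
      finally show ?thesis by (simp only: complex_norm_square[symmetric] of_real_power)
    qed
    thus ?thesis by (simp add: N_def sum_distrib_left)
  qed
  have "cnj (z * of_real N) = z * of_real N"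
  proof -
    have "cnj (z * of_real N) = (\<Sum>i<n. \<Sum>j<n. w $ i * (of_real (M i j) * cnj (w $ j)))"
      by (simp flip: *)
    also have "\<dots> = (\<Sum>j<n. \<Sum>i<n. w $ i * (of_real (M i j) * cnj (w $ j)))"
      by (rule sum.swap)
    also have "\<dots> = z * of_real N"
      unfolding *[symmetric] using M by (intro sum.cong) (auto simp: sym_on_def mult_ac)
    finally show ?thesis .
  qed
  hence "cnj z = z" using N by simp
  hence z: "z = of_real (Re z)" by (metis Reals_cnj_iff of_real_Re)
  have cp: "char_poly B = map_poly complex_of_real (char_poly A)"
    unfolding B_def by (rule of_real_hom.char_poly_hom[OF A])
  have "poly (map_poly complex_of_real (char_poly A)) (of_real (Re z)) = 0"
    using \<open>poly (char_poly B) z = 0\<close> z[symmetric] by (simp add: cp)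
  hence "poly (char_poly A) (Re z) = 0" by (simp only: of_real_hom.poly_map_poly of_real_eq_0_iff)
  hence "eigenvalue A (Re z)" using eigenvalue_root_char_poly[OF A] by simp
  then obtain x where x: "x \<in> carrier_vec n" "x \<noteq> 0\<^sub>v n" "A *\<^sub>v x = Re z \<cdot>\<^sub>v x"
    using A unfolding eigenvalue_def eigenvector_def by auto
  have ex: "(\<Sum>j<n. M i j * x $ j) = Re z * x $ i" if "i < n" for i
  proof -
    have "(A *\<^sub>v x) $ i = (\<Sum>j<n. M i j * x $ j)"
      using that x(1) by (simp add: A_def scalar_prod_def atLeast0LessThan)
    thus ?thesis using that x by simp
  qed
  have "\<exists>i<n. x $ i \<noteq> 0"
    using x(1,2) by (metis carrier_vecD eq_vecI index_zero_vec(1,2))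
  then obtain i1 where i1: "i1 < n" "x $ i1 \<noteq> 0" by auto
  define L where "L = (\<Sum>i<n. (x $ i) ^ 2)"
  have L: "L > 0" unfolding L_def
    using i1 by (intro sum_pos2[where i = i1]) auto
  have "(\<Sum>i<n. (x $ i / sqrt L) ^ 2) = 1"
    using L by (simp add: power_divide L_def flip: sum_divide_distrib)
  moreover have "(\<Sum>j<n. M i j * (x $ j / sqrt L)) = Re z * (x $ i / sqrt L)" if "i < n" for i
    using ex[OF that] by (simp add: flip: sum_divide_distrib)
  ultimately show ?thesis
    by (intro exI[of _ "\<lambda>i. x $ i / sqrt L"] exI[of _ "Re z"]) auto
qed

text \<open>The reflection that exchanges \<open>v\<close> with the first unit vector is orthogonal and has
  \<open>v\<close> as its first column. It completes a unit vector to an orthonormal basis without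
  Gram--Schmidt.\<close>

lemma orthonormal_householder:
  assumes v: "(\<Sum>i<n. v i ^ 2) = (1::real)" and n: "n > 0"
  shows "\<exists>Q. orthonormal n Q \<and> (\<forall>i<n. Q i 0 = v i) \<and> sym_on n Q"
proof (cases "\<forall>i<n. v i = of_bool (i = 0)")
  case True
  thus ?thesis
    by (intro exI[of _ "\<lambda>i j. of_bool (i = j)"]) (auto simp: orthonormal_def sym_on_def sum_of_bool_collapse)
next
  case False
  define w where "w = (\<lambda>i. v i - of_bool (i = 0))"
  define N where "N = (\<Sum>i<n. w i ^ 2)"
  have N: "N > 0"
  proof -
    from False obtain i where "i < n" "w i \<noteq> 0" by (auto simp: w_def)
    thus ?thesis unfolding N_def by (intro sum_pos2[where i = i]) auto
  qed
  \<comment> \<open>Here \<open>|v| = 1\<close> enters; it makes the first column of the reflection equal to \<open>v\<close>.\<close>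
  have N2: "N = - 2 * w 0"
  proof -
    have "N = (\<Sum>i<n. v i ^ 2 - 2 * (of_bool (i = 0) * v i) + of_bool (i = 0) * 1)"
      unfolding N_def w_def by (intro sum.cong) (auto simp: power2_eq_square algebra_simps)
    also have "\<dots> = (\<Sum>i<n. v i ^ 2) - 2 * (\<Sum>i<n. of_bool (i = 0) * v i) + (\<Sum>i<n. of_bool (i = 0) * 1)"
      by (simp only: sum.distrib sum_subtractf sum_distrib_left)
    also have "\<dots> = 2 - 2 * v 0"
      using n v by (simp only: sum_of_bool_collapse)
    finally show ?thesis by (simp add: w_def)
  qed
  define Q where "Q = (\<lambda>i j. of_bool (i = j) - 2 / N * (w i * w j))"
  have "orthonormal n Q" unfolding orthonormal_def
  proof (intro allI impI)
    fix k l assume kl: "k < n" "l < n"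
    have "(\<Sum>i<n. Q k i * Q l i) = (\<Sum>i<n. of_bool (k = i) * of_bool (l = i)
        - 2 / N * w k * (of_bool (l = i) * w i) - 2 / N * w l * (of_bool (k = i) * w i)
        + (2 / N)^2 * (w k * w l) * w i ^ 2)"
      by (intro sum.cong) (auto simp: Q_def power2_eq_square algebra_simps)
    also have "\<dots> = (\<Sum>i<n. of_bool (k = i) * of_bool (l = i))
        - 2 / N * w k * (\<Sum>i<n. of_bool (l = i) * w i) - 2 / N * w l * (\<Sum>i<n. of_bool (k = i) * w i)
        + (2 / N)^2 * (w k * w l) * (\<Sum>i<n. w i ^ 2)"
      by (simp only: sum.distrib sum_subtractf sum_distrib_left)
    also have "\<dots> = of_bool (k = l)"
      using kl N by (simp only: sum_of_bool_collapse N_def[symmetric]) (auto simp: power2_eq_square field_simps)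
    finally show "(\<Sum>i<n. Q k i * Q l i) = of_bool (k = l)" .
  qed
  moreover have "Q i 0 = v i" if "i < n" for i
  proof -
    have "w 0 \<noteq> 0" using N N2 by auto
    hence "Q i 0 = of_bool (i = 0) + w i" by (simp add: Q_def N2)
    thus ?thesis by (simp add: w_def)
  qed
  moreover have "sym_on n Q" by (auto simp: sym_on_def Q_def)
  ultimately show ?thesis by blast
qed

lemma sum_swap_pairs:
  "(\<Sum>a\<in>A. \<Sum>b\<in>B. \<Sum>x\<in>C. \<Sum>y\<in>D. f a b x y) = (\<Sum>x\<in>C. \<Sum>y\<in>D. \<Sum>a\<in>A. \<Sum>b\<in>B. f a b x y)"
proof -
  have "(\<Sum>a\<in>A. \<Sum>b\<in>B. \<Sum>x\<in>C. \<Sum>y\<in>D. f a b x y) = (\<Sum>a\<in>A. \<Sum>x\<in>C. \<Sum>b\<in>B. \<Sum>y\<in>D. f a b x y)"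
    by (intro sum.cong refl sum.swap)
  also have "\<dots> = (\<Sum>x\<in>C. \<Sum>a\<in>A. \<Sum>b\<in>B. \<Sum>y\<in>D. f a b x y)" by (rule sum.swap)
  also have "\<dots> = (\<Sum>x\<in>C. \<Sum>a\<in>A. \<Sum>y\<in>D. \<Sum>b\<in>B. f a b x y)" by (intro sum.cong refl sum.swap)
  also have "\<dots> = (\<Sum>x\<in>C. \<Sum>y\<in>D. \<Sum>a\<in>A. \<Sum>b\<in>B. f a b x y)" by (intro sum.cong refl sum.swap)
  finally show ?thesis .
qed

lemma sum_weighted_swap:
  fixes a :: "nat \<Rightarrow> real"
  shows "(\<Sum>i<n. (\<Sum>k<n. a k * f k i) * g i) = (\<Sum>k<n. a k * (\<Sum>i<n. f k i * g i))"
  unfolding sum_distrib_left sum_distrib_right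
  by (subst sum.swap) (simp only: mult_ac)

text \<open>Induction on the dimension: conjugating by a Householder reflection whose first column is
  a unit eigenvector splits off a block of size one, and symmetry makes the rest of the first row vanish as
  well. The remaining block is symmetric of smaller size.\<close>

theorem symmetric_diagonalizable:
  assumes "sym_on n M"
  shows "\<exists>U l. diagonalizes n U l M"
  using assms
proof (induction n arbitrary: M)
  case 0
  show ?case by (auto simp: diagonalizes_def orthonormal_def)
next
  case (Suc m M)
  note sum.lessThan_Suc [simp del]
  let ?n = "Suc m"
  obtain v e where v: "(\<Sum>i<?n. v i ^ 2) = 1" and ev: "\<And>i. i < ?n \<Longrightarrow> (\<Sum>j<?n. M i j * v j) = e * v i"
    using real_eigenvector_exists[OF Suc.prems] by auto
  obtain Q where Q: "orthonormal ?n Q" "\<And>i. i < ?n \<Longrightarrow> Q i 0 = v i" "sym_on ?n Q"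
    using orthonormal_householder[OF v] by auto
  have Qs: "Q i j = Q j i" if "i < ?n" "j < ?n" for i j using Q(3) that by (auto simp: sym_on_def)
  \<comment> \<open>\<open>B\<close> is \<open>M\<close> conjugated by \<open>Q\<close>; its first column is \<open>e\<close> times the first unit vector.\<close>
  define B where "B = (\<lambda>a b. \<Sum>i<?n. \<Sum>j<?n. Q i a * M i j * Q j b)"
  have symB: "B a b = B b a" if "a < ?n" "b < ?n" for a b
  proof -
    have "B a b = (\<Sum>j<?n. \<Sum>i<?n. Q i a * M i j * Q j b)" unfolding B_def by (rule sum.swap)
    also have "\<dots> = B b a" unfolding B_def
      using Suc.prems by (intro sum.cong) (auto simp: sym_on_def mult_ac)
    finally show ?thesis .
  qed
  have B0: "B a 0 = of_bool (a = 0) * e" if "a < ?n" for a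
  proof -
    have "B a 0 = (\<Sum>i<?n. Q i a * (\<Sum>j<?n. M i j * v j))"
      unfolding B_def sum_distrib_left by (intro sum.cong) (auto simp: Q mult_ac)
    also have "\<dots> = e * (\<Sum>i<?n. Q i a * Q i 0)"
      unfolding sum_distrib_left[of e] by (intro sum.cong) (auto simp: ev Q)
    also have "\<dots> = of_bool (a = 0) * e"
      using orthonormalD(2)[OF Q(1), of a 0] that by simp
    finally show ?thesis .
  qed
  have "sym_on m (\<lambda>i j. B (Suc i) (Suc j))" using symB by (auto simp: sym_on_def)
  from Suc.IH[OF this] obtain Y l where Y: "diagonalizes m Y l (\<lambda>i j. B (Suc i) (Suc j))" by auto
  \<comment> \<open>the block sum of the number \<open>1\<close> and the matrix \<open>Y\<close>\<close>
  define Z where "Z = (\<lambda>k i. case k of 0 \<Rightarrow> of_bool (i = 0) | Suc k' \<Rightarrow> (case i of 0 \<Rightarrow> 0 | Suc i' \<Rightarrow> Y k' i'))"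
  define h where "h = case_nat e l"
  have Z: "orthonormal ?n Z"
    using Y unfolding diagonalizes_def orthonormal_def All_less_Suc2 sum.lessThan_Suc_shift
    by (auto simp: Z_def)
  have BZ: "B a b = (\<Sum>k<?n. h k * Z k a * Z k b)" if "a < ?n" "b < ?n" for a b
    using that Y B0[of a] B0[of b] symB[of a b] unfolding sum.lessThan_Suc_shift
    by (cases a; cases b) (auto simp: diagonalizes_def h_def Z_def)
  define U where "U = (\<lambda>k i. \<Sum>a<?n. Z k a * Q i a)"
  have "orthonormal ?n U" unfolding orthonormal_def
  proof (intro allI impI)
    fix k k' assume k: "k < ?n" "k' < ?n"
    have "(\<Sum>i<?n. U k i * U k' i) = (\<Sum>a<?n. Z k a * (\<Sum>i<?n. Q i a * U k' i))"
      unfolding U_def by (rule sum_weighted_swap)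
    also have "\<dots> = (\<Sum>a<?n. Z k a * Z k' a)"
    proof (intro sum.cong refl arg_cong2[where f = "(*)"])
      fix a assume a: "a \<in> {..<?n}"
      have "(\<Sum>i<?n. Q i a * U k' i) = (\<Sum>i<?n. (\<Sum>b<?n. Z k' b * Q i b) * Q i a)"
        by (simp add: U_def mult_ac)
      also have "\<dots> = (\<Sum>b<?n. Z k' b * (\<Sum>i<?n. Q i b * Q i a))" by (rule sum_weighted_swap)
      also have "\<dots> = (\<Sum>b<?n. Z k' b * of_bool (b = a))"
        using a orthonormalD(2)[OF Q(1)] by (intro sum.cong) auto
      finally show "(\<Sum>i<?n. Q i a * U k' i) = Z k' a" using a by (simp only: sum_of_bool_collapse lessThan_iff)
    qed
    also have "\<dots> = of_bool (k = k')" using orthonormalD(1)[OF Z k] .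
    finally show "(\<Sum>i<?n. U k i * U k' i) = of_bool (k = k')" .
  qed
  moreover have "M i j = (\<Sum>k<?n. h k * U k i * U k j)" if ij: "i < ?n" "j < ?n" for i j
  proof -
    have "(\<Sum>k<?n. h k * U k i * U k j) = (\<Sum>k<?n. \<Sum>a<?n. \<Sum>b<?n. h k * (Z k a * Q i a) * (Z k b * Q j b))"
      unfolding U_def mult.assoc sum_product unfolding sum_distrib_left by (rule refl)
    also have "\<dots> = (\<Sum>a<?n. \<Sum>k<?n. \<Sum>b<?n. h k * (Z k a * Q i a) * (Z k b * Q j b))"
      by (rule sum.swap)
    also have "\<dots> = (\<Sum>a<?n. \<Sum>b<?n. \<Sum>k<?n. h k * (Z k a * Q i a) * (Z k b * Q j b))"
      by (intro sum.cong refl sum.swap)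
    also have "\<dots> = (\<Sum>a<?n. \<Sum>b<?n. B a b * Q i a * Q j b)"
      by (intro sum.cong refl) (simp add: BZ sum_distrib_right sum_distrib_left mult_ac)
    also have "\<dots> = (\<Sum>a<?n. \<Sum>b<?n. \<Sum>x<?n. \<Sum>y<?n. Q x a * M x y * Q y b * Q i a * Q j b)"
      by (simp add: B_def sum_distrib_right)
    also have "\<dots> = (\<Sum>x<?n. \<Sum>y<?n. \<Sum>a<?n. \<Sum>b<?n. Q x a * M x y * Q y b * Q i a * Q j b)"
      by (rule sum_swap_pairs)
    also have "\<dots> = (\<Sum>x<?n. \<Sum>y<?n. M x y * ((\<Sum>a<?n. Q x a * Q i a) * (\<Sum>b<?n. Q y b * Q j b)))"
      unfolding sum_product unfolding sum_distrib_left by (intro sum.cong refl) (simp only: mult_ac)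
    also have "\<dots> = (\<Sum>x<?n. \<Sum>y<?n. M x y * (of_bool (x = i) * of_bool (y = j)))"
      using ij orthonormalD(1)[OF Q(1)] by (intro sum.cong) auto
    also have "\<dots> = (\<Sum>x<?n. of_bool (x = i) * (\<Sum>y<?n. M x y * of_bool (y = j)))"
      unfolding sum_distrib_left by (intro sum.cong refl) (simp only: mult_ac)
    also have "\<dots> = M i j" using ij by (simp only: sum_of_bool_collapse)
    finally show ?thesis by simp
  qed
  ultimately show ?case unfolding diagonalizes_def by blast
qed

lemma order_prod_list_linear:
  "order x (\<Prod>a\<leftarrow>as. [:- a, 1:]) = count_list as (x::real)"
proof (induction as)
  case (Cons a as)
  have "(\<Prod>a\<leftarrow>as. [:- a, 1:]) \<noteq> 0" by (auto simp: prod_list_zero_iff)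
  hence "order x (\<Prod>a\<leftarrow>a # as. [:- a, 1:]) = order x [:- a, 1:] + count_list as x"
    using Cons by (simp add: order_mult del: mult_pCons_left)
  also have "order x [:- a, 1:] = of_bool (a = x)"
    using order_power_n_n[of a 1] by (auto intro: order_0I)
  finally show ?case by auto
qed simp

text \<open>Links the energy, defined through multiplicities of roots of the characteristic polynomial,
  to an explicit diagonalisation: similar matrices share the characteristic polynomial, and the multiplicity of
  \<open>x\<close> is the number of indices with \<open>l k = x\<close>.\<close>

lemma energy_eq_sum_eigenvalues:
  assumes "diagonalizes n U l M"
  shows "energy (mat n n (\<lambda>(i, j). M i j)) = (\<Sum>k<n. \<bar>l k\<bar>)"
proof -
  define A where "A = mat n n (\<lambda>(i, j). M i j)"
  define D where "D = mat n n (\<lambda>(i, j). if i = j then l i else 0)"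
  define P where "P = mat n n (\<lambda>(i, j). U i j)"
  have car: "A \<in> carrier_mat n n" "D \<in> carrier_mat n n" "P \<in> carrier_mat n n"
    by (auto simp: A_def D_def P_def)
  have PP: "P * transpose_mat P = 1\<^sub>m n"
    using assms by (intro eq_matI)
      (auto simp: P_def diagonalizes_def orthonormal_def scalar_prod_def atLeast0LessThan one_mat_def)
  have PP': "transpose_mat P * P = 1\<^sub>m n"
    using mat_mult_left_right_inverse[OF car(3) _ PP] car by simp
  have DP: "D * P = mat n n (\<lambda>(k, j). l k * U k j)"
    by (rule eq_matI) (auto simp: D_def P_def scalar_prod_def if_distrib if_distribR cong: if_cong)
  have "A = transpose_mat P * (D * P)"
    using assms unfolding DP
    by (intro eq_matI) (auto simp: A_def P_def diagonalizes_def scalar_prod_def atLeast0LessThan mult_ac)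
  hence "A = transpose_mat P * D * P" using car by (simp add: assoc_mult_mat[of _ n n _ n _ n])
  hence "similar_mat A D" unfolding similar_mat_def similar_mat_wit_def Let_def
    using car PP PP' by (intro exI[of _ "transpose_mat P"] exI[of _ P]) auto
  hence "char_poly A = char_poly D" by (rule char_poly_similar)
  also have "\<dots> = (\<Prod>a\<leftarrow>diag_mat D. [:- a, 1:])"
    by (rule char_poly_upper_triangular[of _ n]) (auto simp: D_def)
  also have "diag_mat D = map l [0..<n]" by (auto simp: diag_mat_def D_def)
  finally have cp: "char_poly A = (\<Prod>a\<leftarrow>map l [0..<n]. [:- a, 1:])" .
  let ?ls = "map l [0..<n]"
  have ev: "{x. eigenvalue A x} = set ?ls"
    unfolding eigenvalue_root_char_poly[OF car(1)] cp
    by (auto simp: poly_prod_list o_def prod_list_zero_iff)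
  have "energy A = (\<Sum>x\<in>set ?ls. real (count_list ?ls x) * \<bar>x\<bar>)"
    unfolding energy_def ev unfolding cp order_prod_list_linear ..
  also have "\<dots> = (\<Sum>x\<in>set ?ls. (\<Sum>k | k < n \<and> l k = x. \<bar>l k\<bar>))"
  proof (intro sum.cong refl)
    fix x
    have "count_list ?ls x = card {k. k < n \<and> l k = x}"
      by (auto simp: count_list_eq_length_filter length_filter_conv_card intro!: arg_cong[where f = card])
    thus "real (count_list ?ls x) * \<bar>x\<bar> = (\<Sum>k | k < n \<and> l k = x. \<bar>l k\<bar>)" by simp
  qed
  also have "\<dots> = (\<Sum>k<n. \<bar>l k\<bar>)"
    using sum.group[of "{..<n}" "set ?ls" l "\<lambda>k. \<bar>l k\<bar>"] by (simp add: atLeast0LessThan)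
  finally show ?thesis by (simp add: A_def)
qed

section \<open>The trace norm\<close>

definition trace_norm :: "nat \<Rightarrow> (nat \<Rightarrow> nat \<Rightarrow> real) \<Rightarrow> real" where
  "trace_norm n M = energy (mat n n (\<lambda>(i, j). M i j))"

definition quad_form :: "nat \<Rightarrow> (nat \<Rightarrow> nat \<Rightarrow> real) \<Rightarrow> (nat \<Rightarrow> real) \<Rightarrow> real" where
  "quad_form n M x = (\<Sum>i<n. \<Sum>j<n. x i * M i j * x j)"

lemma trace_norm_eq_sum_eigenvalues: "diagonalizes n U l M \<Longrightarrow> trace_norm n M = (\<Sum>k<n. \<bar>l k\<bar>)"
  unfolding trace_norm_def by (rule energy_eq_sum_eigenvalues)

lemma parseval:
  assumes "orthonormal n V"
  shows "(\<Sum>k<n. (\<Sum>i<n. V k i * x i)\<^sup>2) = (\<Sum>i<n. (x i)\<^sup>2)"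
proof -
  have "(\<Sum>k<n. (\<Sum>i<n. V k i * x i)\<^sup>2) = (\<Sum>k<n. \<Sum>i<n. x i * V k i * (\<Sum>j<n. V k j * x j))"
    by (simp add: power2_eq_square sum_distrib_right mult_ac)
  also have "\<dots> = (\<Sum>i<n. \<Sum>k<n. x i * V k i * (\<Sum>j<n. V k j * x j))"
    by (rule sum.swap)
  also have "\<dots> = (\<Sum>i<n. x i * (\<Sum>k<n. (\<Sum>j<n. x j * V k j) * V k i))"
    unfolding sum_distrib_left by (intro sum.cong refl) (simp add: sum_distrib_left mult_ac)
  also have "\<dots> = (\<Sum>i<n. x i * (\<Sum>j<n. x j * (\<Sum>k<n. V k j * V k i)))"
    unfolding sum_weighted_swap ..
  also have "\<dots> = (\<Sum>i<n. x i * (\<Sum>j<n. x j * of_bool (j = i)))"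
    using orthonormalD(2)[OF assms] by (intro sum.cong refl arg_cong2[where f = "(*)"]) auto
  also have "\<dots> = (\<Sum>i<n. (x i)\<^sup>2)"
    by (intro sum.cong refl) (simp only: sum_of_bool_collapse power2_eq_square lessThan_iff)
  finally show ?thesis .
qed

lemma quad_form_spectral:
  assumes "diagonalizes n U l M"
  shows "quad_form n M x = (\<Sum>m<n. l m * (\<Sum>i<n. U m i * x i)\<^sup>2)"
proof -
  have "quad_form n M x = (\<Sum>i<n. \<Sum>j<n. \<Sum>m<n. l m * (U m i * x i) * (U m j * x j))"
    using assms unfolding quad_form_def diagonalizes_def
    by (intro sum.cong refl) (simp add: sum_distrib_left sum_distrib_right mult_ac)
  also have "\<dots> = (\<Sum>i<n. \<Sum>m<n. \<Sum>j<n. l m * (U m i * x i) * (U m j * x j))"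
    by (intro sum.cong refl sum.swap)
  also have "\<dots> = (\<Sum>m<n. \<Sum>i<n. \<Sum>j<n. l m * (U m i * x i) * (U m j * x j))"
    by (rule sum.swap)
  also have "\<dots> = (\<Sum>m<n. l m * (\<Sum>i<n. U m i * x i)\<^sup>2)"
    unfolding power2_eq_square sum_product unfolding sum_distrib_left by (simp add: mult_ac)
  finally show ?thesis .
qed

lemma quad_form_eigenvector:
  assumes "diagonalizes n U l M" "k < n"
  shows "quad_form n M (U k) = l k"
proof -
  have o: "orthonormal n U" using assms by (simp add: diagonalizes_def)
  have "quad_form n M (U k) = (\<Sum>m<n. l m * (of_bool (m = k))\<^sup>2)"
    unfolding quad_form_spectral[OF assms(1)] using orthonormalD(1)[OF o] assms(2)
    by (intro sum.cong refl) auto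
  also have "\<dots> = (\<Sum>m<n. l m * of_bool (m = k))" by (intro sum.cong) auto
  also have "\<dots> = l k" using assms(2) by (simp only: sum_of_bool_collapse)
  finally show ?thesis .
qed

text \<open>In the eigenbasis, \<open>quad_form n M (V k)\<close> is the average of the eigenvalues with weights the squared
  coordinates of \<open>V k\<close>; by Parseval each eigenvalue receives total weight one. Together with the next lemma this
  is the variational formula for the trace norm, from which the triangle inequality and all upper bounds
  follow.\<close>

lemma sum_abs_quad_form_le_trace_norm:
  assumes M: "sym_on n M" and V: "orthonormal n V"
  shows "(\<Sum>k<n. \<bar>quad_form n M (V k)\<bar>) \<le> trace_norm n M"
proof -
  obtain U l where U: "diagonalizes n U l M" using symmetric_diagonalizable[OF M] by auto
  hence o: "orthonormal n U" by (simp add: diagonalizes_def)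
  have "(\<Sum>k<n. \<bar>quad_form n M (V k)\<bar>) \<le> (\<Sum>k<n. \<Sum>m<n. \<bar>l m\<bar> * (\<Sum>i<n. V k i * U m i)\<^sup>2)"
    unfolding quad_form_spectral[OF U]
    by (intro sum_mono order_trans[OF sum_abs]) (simp add: abs_mult mult.commute)
  also have "\<dots> = (\<Sum>m<n. \<bar>l m\<bar> * (\<Sum>k<n. (\<Sum>i<n. V k i * U m i)\<^sup>2))"
    unfolding sum_distrib_left by (rule sum.swap)
  also have "\<dots> = (\<Sum>m<n. \<bar>l m\<bar>)"
    unfolding parseval[OF V] using orthonormalD(1)[OF o] by (simp add: power2_eq_square)
  finally show ?thesis using trace_norm_eq_sum_eigenvalues[OF U] by simp
qed

lemma trace_norm_attained:
  assumes "sym_on n M"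
  shows "\<exists>V. orthonormal n V \<and> trace_norm n M = (\<Sum>k<n. \<bar>quad_form n M (V k)\<bar>)"
proof -
  obtain U l where U: "diagonalizes n U l M" using symmetric_diagonalizable[OF assms] by auto
  thus ?thesis using quad_form_eigenvector[OF U] trace_norm_eq_sum_eigenvalues[OF U]
    by (intro exI[of _ U]) (auto simp: diagonalizes_def)
qed

lemma trace_norm_triangle:
  assumes "sym_on n A" "sym_on n B"
  shows "trace_norm n (\<lambda>i j. A i j + B i j) \<le> trace_norm n A + trace_norm n B"
proof -
  have "sym_on n (\<lambda>i j. A i j + B i j)" using assms by (auto simp: sym_on_def)
  then obtain V where V: "orthonormal n V"
    "trace_norm n (\<lambda>i j. A i j + B i j) = (\<Sum>k<n. \<bar>quad_form n (\<lambda>i j. A i j + B i j) (V k)\<bar>)"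
    using trace_norm_attained by blast
  have "\<dots> \<le> (\<Sum>k<n. \<bar>quad_form n A (V k)\<bar> + \<bar>quad_form n B (V k)\<bar>)"
    by (intro sum_mono) (simp add: quad_form_def algebra_simps sum.distrib abs_triangle_ineq)
  also have "\<dots> \<le> trace_norm n A + trace_norm n B"
    using sum_abs_quad_form_le_trace_norm[OF _ V(1)] assms by (simp add: sum.distrib add_mono)
  finally show ?thesis using V(2) by simp
qed

lemma trace_norm_scale:
  assumes "sym_on n M"
  shows "trace_norm n (\<lambda>i j. c * M i j) = \<bar>c\<bar> * trace_norm n M"
proof -
  obtain U l where U: "diagonalizes n U l M" using symmetric_diagonalizable[OF assms] by auto
  hence "diagonalizes n U (\<lambda>k. c * l k) (\<lambda>i j. c * M i j)"
    by (auto simp: diagonalizes_def sum_distrib_left mult_ac)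
  thus ?thesis using U
    by (simp add: trace_norm_eq_sum_eigenvalues abs_mult sum_distrib_left)
qed

lemma trace_norm_diff_le:
  assumes "sym_on n A" "sym_on n B"
  shows "\<bar>trace_norm n A - trace_norm n B\<bar> \<le> trace_norm n (\<lambda>i j. A i j - B i j)"
proof -
  have D: "sym_on n (\<lambda>i j. A i j - B i j)" using assms by (auto simp: sym_on_def)
  have "trace_norm n A \<le> trace_norm n (\<lambda>i j. A i j - B i j) + trace_norm n B"
    using trace_norm_triangle[OF D assms(2)] by simp
  moreover have D': "sym_on n (\<lambda>i j. - 1 * (A i j - B i j))" using assms by (auto simp: sym_on_def)
  have "trace_norm n B \<le> trace_norm n (\<lambda>i j. - 1 * (A i j - B i j)) + trace_norm n A"
    using trace_norm_triangle[OF D' assms(1)] by simp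
  moreover have "trace_norm n (\<lambda>i j. - 1 * (A i j - B i j)) = trace_norm n (\<lambda>i j. A i j - B i j)"
    unfolding trace_norm_scale[OF D] by simp
  ultimately show ?thesis by linarith
qed

lemma orthonormal_cross_le:
  assumes "orthonormal n V" "i < n" "j < n"
  shows "(\<Sum>k<n. \<bar>V k i\<bar> * \<bar>V k j\<bar>) \<le> 1"
proof -
  have "(\<Sum>k<n. \<bar>V k i\<bar> * \<bar>V k j\<bar>) \<le> (\<Sum>k<n. (V k i * V k i + V k j * V k j) / 2)"
  proof (intro sum_mono)
    fix k
    show "\<bar>V k i\<bar> * \<bar>V k j\<bar> \<le> (V k i * V k i + V k j * V k j) / 2"
      using sum_squares_bound[of "\<bar>V k i\<bar>" "\<bar>V k j\<bar>"] by (simp add: power2_eq_square)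
  qed
  also have "\<dots> = 1"
    using orthonormalD(2)[OF assms(1)] assms(2,3) by (simp add: sum.distrib flip: sum_divide_distrib)
  finally show ?thesis .
qed

text \<open>Used to bound the effect of a single edge. It gives a constant, whereas comparison
  with the Frobenius norm would lose a factor \<open>sqrt n\<close> and be too weak for concentration.\<close>

lemma trace_norm_le_sum_abs:
  assumes "sym_on n M"
  shows "trace_norm n M \<le> (\<Sum>i<n. \<Sum>j<n. \<bar>M i j\<bar>)"
proof -
  obtain V where V: "orthonormal n V" "trace_norm n M = (\<Sum>k<n. \<bar>quad_form n M (V k)\<bar>)"
    using trace_norm_attained[OF assms] by blast
  have "trace_norm n M \<le> (\<Sum>k<n. \<Sum>i<n. \<Sum>j<n. \<bar>V k i * M i j * V k j\<bar>)"
    unfolding V(2) quad_form_def by (intro sum_mono order_trans[OF sum_abs] order_refl)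
  also have "\<dots> = (\<Sum>i<n. \<Sum>k<n. \<Sum>j<n. \<bar>V k i * M i j * V k j\<bar>)" by (rule sum.swap)
  also have "\<dots> = (\<Sum>i<n. \<Sum>j<n. \<Sum>k<n. \<bar>V k i * M i j * V k j\<bar>)" by (intro sum.cong refl sum.swap)
  also have "\<dots> = (\<Sum>i<n. \<Sum>j<n. \<bar>M i j\<bar> * (\<Sum>k<n. \<bar>V k i\<bar> * \<bar>V k j\<bar>))"
    by (simp add: sum_distrib_left abs_mult mult_ac)
  also have "\<dots> \<le> (\<Sum>i<n. \<Sum>j<n. \<bar>M i j\<bar>)"
    using orthonormal_cross_le[OF V(1)] by (intro sum_mono mult_left_le) auto
  finally show ?thesis .
qed

text \<open>Both sides are the squared Frobenius norm, computed in two orthonormal bases.\<close>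

lemma diagonalizes_sum_squares:
  assumes "diagonalizes n U l M"
  shows "(\<Sum>k<n. (l k)\<^sup>2) = (\<Sum>i<n. \<Sum>j<n. (M i j)\<^sup>2)"
proof -
  have o: "orthonormal n U" using assms by (simp add: diagonalizes_def)
  have "(\<Sum>j<n. (M i j)\<^sup>2) = (\<Sum>k<n. (U k i * l k)\<^sup>2)" if "i < n" for i
  proof -
    have "(\<Sum>j<n. (M i j)\<^sup>2) = (\<Sum>j<n. (\<Sum>k<n. U k j * (U k i * l k))\<^sup>2)"
      using assms that by (auto simp: diagonalizes_def mult_ac intro!: sum.cong)
    also have "\<dots> = (\<Sum>k<n. (U k i * l k)\<^sup>2)"
      by (rule parseval[OF orthonormal_transpose[OF o]])
    finally show ?thesis .
  qed
  hence "(\<Sum>i<n. \<Sum>j<n. (M i j)\<^sup>2) = (\<Sum>i<n. \<Sum>k<n. (U k i * l k)\<^sup>2)" by simp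
  also have "\<dots> = (\<Sum>k<n. \<Sum>i<n. (U k i * l k)\<^sup>2)" by (rule sum.swap)
  also have "\<dots> = (\<Sum>k<n. (l k)\<^sup>2 * (\<Sum>i<n. U k i * U k i))"
    by (simp add: power_mult_distrib sum_distrib_left power2_eq_square mult_ac)
  also have "\<dots> = (\<Sum>k<n. (l k)\<^sup>2)" using orthonormalD(1)[OF o] by simp
  finally show ?thesis ..
qed

lemma trace_norm_sq_le:
  assumes "sym_on n M"
  shows "(trace_norm n M)\<^sup>2 \<le> real n * (\<Sum>i<n. \<Sum>j<n. (M i j)\<^sup>2)"
proof -
  obtain U l where U: "diagonalizes n U l M" using symmetric_diagonalizable[OF assms] by auto
  have "(\<Sum>k<n. 1 * \<bar>l k\<bar>)\<^sup>2 \<le> (\<Sum>k<n. 1\<^sup>2) * (\<Sum>k<n. \<bar>l k\<bar>\<^sup>2)"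
    by (rule Cauchy_Schwarz_ineq_sum)
  thus ?thesis
    using trace_norm_eq_sum_eigenvalues[OF U] diagonalizes_sum_squares[OF U] by simp
qed

text \<open>The all-ones matrix is positive semidefinite, so its trace norm is its trace. The Frobenius
  bound would give \<open>n powr (3 / 2)\<close>, which is of the same order as the main term.\<close>

lemma trace_norm_all_ones: "trace_norm n (\<lambda>_ _. 1) \<le> real n"
proof -
  have "sym_on n (\<lambda>_ _. 1)" by (simp add: sym_on_def)
  then obtain V where V: "orthonormal n V" "trace_norm n (\<lambda>_ _. 1) = (\<Sum>k<n. \<bar>quad_form n (\<lambda>_ _. 1) (V k)\<bar>)"
    using trace_norm_attained by blast
  have "quad_form n (\<lambda>_ _. 1) x = (\<Sum>i<n. x i * 1)\<^sup>2" for x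
    by (simp add: quad_form_def power2_eq_square sum_product)
  hence "trace_norm n (\<lambda>_ _. 1) = (\<Sum>k<n. (\<Sum>i<n. V k i * 1)\<^sup>2)"
    by (simp add: V(2))
  also have "\<dots> = (\<Sum>i<n. 1\<^sup>2)" by (rule parseval[OF V(1)])
  finally show ?thesis by simp
qed

section \<open>The resolvent\<close>

text \<open>The entries of \<open>(M - z)\<^sup>-\<^sup>1\<close>, written in a chosen diagonalisation of \<open>M\<close>.\<close>

definition resolvent :: "nat \<Rightarrow> (nat \<Rightarrow> nat \<Rightarrow> real) \<Rightarrow> complex \<Rightarrow> nat \<Rightarrow> nat \<Rightarrow> complex" where
  "resolvent n M z i j = (case (SOME (U, l). diagonalizes n U l M) of (U, l) \<Rightarrow>
     \<Sum>k<n. of_real (U k i * U k j) / (of_real (l k) - z))"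

lemma resolvent_spectral:
  assumes "sym_on n M"
  obtains U l where "diagonalizes n U l M"
    "\<And>z i j. resolvent n M z i j = (\<Sum>k<n. of_real (U k i * U k j) / (of_real (l k) - z))"
proof -
  define Ul where "Ul = (SOME (U, l). diagonalizes n U l M)"
  have "\<exists>x. case x of (U, l) \<Rightarrow> diagonalizes n U l M" using symmetric_diagonalizable[OF assms] by auto
  hence "case Ul of (U, l) \<Rightarrow> diagonalizes n U l M" unfolding Ul_def by (rule someI_ex)
  thus ?thesis
    by (intro that[of "fst Ul" "snd Ul"]) (auto simp: resolvent_def Ul_def[symmetric] split: prod.splits)
qed

lemma resolvent_sym: "resolvent n M z i j = resolvent n M z j i"
  by (simp add: resolvent_def mult.commute)

lemma norm_resolvent_eigenvalue:
  assumes "Im z > 0"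
  shows "norm (1 / (of_real l - z)) \<le> 1 / Im z"
proof -
  have "Im z \<le> norm (of_real l - z)"
    using abs_Im_le_cmod[of "of_real l - z"] by simp
  thus ?thesis using assms by (simp add: norm_divide divide_simps)
qed

lemma resolvent_inverse:
  assumes M: "sym_on n M" and z: "Im z > 0" and ij: "i < n" "m < n"
  shows "(\<Sum>j<n. (of_real (M i j) - z * of_bool (i = j)) * resolvent n M z j m) = of_bool (i = m)"
proof -
  obtain U l where U: "diagonalizes n U l M"
    and R: "\<And>z i j. resolvent n M z i j = (\<Sum>k<n. of_real (U k i * U k j) / (of_real (l k) - z))"
    using resolvent_spectral[OF M] by blast
  have o: "orthonormal n U" using U by (simp add: diagonalizes_def)
  have nz: "of_real (l k) - z \<noteq> 0" for k using z by (auto simp: complex_eq_iff)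
  have A: "of_real (M i j) - z * of_bool (i = j) = (\<Sum>k<n. (of_real (l k) - z) * of_real (U k i * U k j))"
    if "j < n" for j
  proof -
    have "of_bool (i = j) = complex_of_real (\<Sum>k<n. U k i * U k j)"
      unfolding orthonormalD(2)[OF o ij(1) that] by simp
    hence "of_bool (i = j) = (\<Sum>k<n. complex_of_real (U k i * U k j))"
      by (simp only: of_real_sum)
    moreover have "complex_of_real (M i j) = (\<Sum>k<n. of_real (l k) * of_real (U k i * U k j))"
      using U ij that by (simp add: diagonalizes_def mult_ac)
    ultimately show ?thesis by (simp only: sum_distrib_left left_diff_distrib sum_subtractf)
  qed
  have "(\<Sum>j<n. (of_real (M i j) - z * of_bool (i = j)) * resolvent n M z j m) =
     (\<Sum>j<n. \<Sum>k<n. \<Sum>k'<n. (of_real (l k) - z) * of_real (U k i) * (of_real (U k j * U k' j) * (of_real (U k' m) / (of_real (l k') - z))))"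
    unfolding R using A
    by (intro sum.cong refl) (simp add: sum_product mult_ac)
  also have "\<dots> = (\<Sum>k<n. \<Sum>j<n. \<Sum>k'<n. (of_real (l k) - z) * of_real (U k i) * (of_real (U k j * U k' j) * (of_real (U k' m) / (of_real (l k') - z))))"
    by (rule sum.swap)
  also have "\<dots> = (\<Sum>k<n. \<Sum>k'<n. \<Sum>j<n. (of_real (l k) - z) * of_real (U k i) * (of_real (U k j * U k' j) * (of_real (U k' m) / (of_real (l k') - z))))"
    by (intro sum.cong refl sum.swap)
  also have "\<dots> = (\<Sum>k<n. (of_real (l k) - z) * of_real (U k i) * (\<Sum>k'<n. of_real (\<Sum>j<n. U k j * U k' j) * (of_real (U k' m) / (of_real (l k') - z))))"
    by (simp only: sum_distrib_left sum_distrib_right of_real_sum)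
  also have "\<dots> = (\<Sum>k<n. (of_real (l k) - z) * of_real (U k i) * (\<Sum>k'<n. of_bool (k = k') * (of_real (U k' m) / (of_real (l k') - z))))"
    using orthonormalD(1)[OF o] by (intro sum.cong refl arg_cong2[where f = "(*)"]) auto
  also have "\<dots> = (\<Sum>k<n. (of_real (l k) - z) * of_real (U k i) * (of_real (U k m) / (of_real (l k) - z)))"
    by (intro sum.cong refl) (simp only: sum_of_bool_collapse lessThan_iff)
  also have "\<dots> = of_real (\<Sum>k<n. U k i * U k m)"
    using nz by simp
  also have "\<dots> = of_bool (i = m)" unfolding orthonormalD(2)[OF o ij] by simp
  finally show ?thesis .
qed

lemma norm_resolvent_le:
  assumes M: "sym_on n M" and z: "Im z > 0" and ij: "i < n" "j < n"
  shows "norm (resolvent n M z i j) \<le> 1 / Im z"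
proof -
  obtain U l where U: "diagonalizes n U l M"
    and R: "\<And>z i j. resolvent n M z i j = (\<Sum>k<n. of_real (U k i * U k j) / (of_real (l k) - z))"
    using resolvent_spectral[OF M] by blast
  have o: "orthonormal n U" using U by (simp add: diagonalizes_def)
  have "norm (resolvent n M z i j) \<le> (\<Sum>k<n. \<bar>U k i\<bar> * \<bar>U k j\<bar> * (1 / Im z))"
    unfolding R
  proof (rule sum_norm_le)
    fix k
    have "norm (of_real (U k i * U k j) / (of_real (l k) - z)) = \<bar>U k i\<bar> * \<bar>U k j\<bar> * norm (1 / (of_real (l k) - z))"
      by (simp add: norm_divide norm_mult abs_mult)
    thus "norm (of_real (U k i * U k j) / (of_real (l k) - z)) \<le> \<bar>U k i\<bar> * \<bar>U k j\<bar> * (1 / Im z)"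
      using norm_resolvent_eigenvalue[OF z, of "l k"] by (simp only: mult_left_mono abs_ge_zero mult_nonneg_nonneg)
  qed
  also have "\<dots> = (\<Sum>k<n. \<bar>U k i\<bar> * \<bar>U k j\<bar>) * (1 / Im z)" by (simp only: sum_distrib_right)
  also have "\<dots> \<le> 1 * (1 / Im z)"
    using orthonormal_cross_le[OF o ij] z by (intro mult_right_mono) auto
  finally show ?thesis by simp
qed

text \<open>Parseval applied to the real and the imaginary part of a row. This bound on a whole row, rather than
  on single entries, is what makes the trace of the resolvent insensitive to a single edge.\<close>

lemma resolvent_row_norm:
  assumes M: "sym_on n M" and z: "Im z > 0" and i: "i < n"
  shows "(\<Sum>j<n. (norm (resolvent n M z i j))\<^sup>2) \<le> 1 / (Im z)\<^sup>2"
proof -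
  obtain U l where U: "diagonalizes n U l M"
    and R: "\<And>z i j. resolvent n M z i j = (\<Sum>k<n. of_real (U k i * U k j) / (of_real (l k) - z))"
    using resolvent_spectral[OF M] by blast
  have o: "orthonormal n U" using U by (simp add: diagonalizes_def)
  define g where "g k = 1 / (of_real (l k) - z)" for k
  have R': "resolvent n M z i j = (\<Sum>k<n. of_real (U k j * U k i) * g k)" for j
    unfolding R g_def by (simp add: mult_ac)
  have Re: "Re (resolvent n M z i j) = (\<Sum>k<n. U k j * (U k i * Re (g k)))" for j
    unfolding R' by (simp add: mult_ac)
  have Im: "Im (resolvent n M z i j) = (\<Sum>k<n. U k j * (U k i * Im (g k)))" for j
    unfolding R' by (simp add: mult_ac)
  have "(\<Sum>j<n. (norm (resolvent n M z i j))\<^sup>2) =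
      (\<Sum>k<n. (U k i * Re (g k))\<^sup>2) + (\<Sum>k<n. (U k i * Im (g k))\<^sup>2)"
    unfolding cmod_power2 sum.distrib Re Im parseval[OF orthonormal_transpose[OF o]] ..
  also have "\<dots> = (\<Sum>k<n. (U k i * U k i) * (norm (g k))\<^sup>2)"
    unfolding cmod_power2 power_mult_distrib sum.distrib[symmetric]
    by (intro sum.cong refl) (simp add: power2_eq_square algebra_simps)
  also have "\<dots> \<le> (\<Sum>k<n. (U k i * U k i) * (1 / Im z)\<^sup>2)"
    using norm_resolvent_eigenvalue[OF z] unfolding g_def
    by (intro sum_mono mult_left_mono power_mono) auto
  also have "\<dots> = 1 / (Im z)\<^sup>2"
    using orthonormalD(2)[OF o i i] by (simp add: power_divide flip: sum_divide_distrib)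
  finally show ?thesis .
qed

text \<open>Insert \<open>(M' - z) R' = 1\<close> and \<open>R (M - z) = 1\<close> into \<open>R (M' - z) R' - R (M - z) R'\<close>.\<close>

lemma resolvent_identity:
  assumes M: "sym_on n M" "sym_on n M'" and z: "Im z > 0" and ab: "a < n" "b < n"
  shows "resolvent n M z a b - resolvent n M' z a b =
    (\<Sum>i<n. \<Sum>j<n. resolvent n M z a i * of_real (M' i j - M i j) * resolvent n M' z j b)"
proof -
  let ?R = "resolvent n M z" and ?R' = "resolvent n M' z"
  let ?d = "\<lambda>i j. z * of_bool (i = (j::nat))"
  have "(\<Sum>i<n. \<Sum>j<n. ?R a i * of_real (M' i j - M i j) * ?R' j b) =
     (\<Sum>i<n. \<Sum>j<n. ?R a i * ((of_real (M' i j) - ?d i j) * ?R' j b)) -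
     (\<Sum>i<n. \<Sum>j<n. ((of_real (M j i) - ?d j i) * ?R i a) * ?R' j b)"
    unfolding sum_subtractf[symmetric] using M(1)
    by (intro sum.cong refl) (auto simp: sym_on_def resolvent_sym[of _ _ _ a] algebra_simps)
  also have "(\<Sum>i<n. \<Sum>j<n. ?R a i * ((of_real (M' i j) - ?d i j) * ?R' j b)) = ?R a b"
  proof -
    have "(\<Sum>i<n. \<Sum>j<n. ?R a i * ((of_real (M' i j) - ?d i j) * ?R' j b)) = (\<Sum>i<n. ?R a i * of_bool (i = b))"
      unfolding sum_distrib_left[symmetric] using resolvent_inverse[OF M(2) z _ ab(2)]
      by (intro sum.cong refl arg_cong2[where f = "(*)"]) auto
    thus ?thesis using ab by (simp only: sum_of_bool_collapse)
  qed
  also have "(\<Sum>i<n. \<Sum>j<n. ((of_real (M j i) - ?d j i) * ?R i a) * ?R' j b) = ?R' a b"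
  proof -
    have "(\<Sum>i<n. \<Sum>j<n. ((of_real (M j i) - ?d j i) * ?R i a) * ?R' j b) =
       (\<Sum>j<n. \<Sum>i<n. ((of_real (M j i) - ?d j i) * ?R i a) * ?R' j b)" by (rule sum.swap)
    also have "\<dots> = (\<Sum>j<n. of_bool (j = a) * ?R' j b)"
      unfolding sum_distrib_right[symmetric] using resolvent_inverse[OF M(1) z _ ab(1)]
      by (intro sum.cong refl arg_cong2[where f = "(*)"]) auto
    finally show ?thesis using ab by (simp only: sum_of_bool_collapse)
  qed
  finally show ?thesis by simp
qed

text \<open>The resolvent identity for two matrices that differ exactly by the adjacency matrix of the
  single edge \<open>{x, y}\<close>.\<close>

lemma resolvent_edge_perturbation:
  assumes M: "sym_on n M" "sym_on n M'" and z: "Im z > 0" and ab: "a < n" "b < n"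
    and xy: "x < n" "y < n" "x \<noteq> y"
    and D: "\<And>i j. i < n \<Longrightarrow> j < n \<Longrightarrow> M i j - M' i j = of_bool ({i, j} = {x, y})"
  shows "resolvent n M z a b - resolvent n M' z a b =
    - (resolvent n M z a x * resolvent n M' z y b + resolvent n M z a y * resolvent n M' z x b)"
proof -
  let ?R = "resolvent n M z" and ?R' = "resolvent n M' z"
  have "?R a b - ?R' a b = (\<Sum>i<n. \<Sum>j<n. of_bool (i = x) * (of_bool (j = y) * - (?R a i * ?R' j b))
      + of_bool (i = y) * (of_bool (j = x) * - (?R a i * ?R' j b)))"
    unfolding resolvent_identity[OF M z ab]
  proof (intro sum.cong refl)
    fix i j assume "i \<in> {..<n}" "j \<in> {..<n}"
    hence "M' i j - M i j = - of_bool ({i, j} = {x, y})" using D[of i j] by simp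
    hence "M' i j - M i j = - (of_bool (i = x) * of_bool (j = y) + of_bool (i = y) * of_bool (j = x))"
      using xy(3) by (auto simp: doubleton_eq_iff)
    thus "?R a i * of_real (M' i j - M i j) * ?R' j b = of_bool (i = x) * (of_bool (j = y) * - (?R a i * ?R' j b))
      + of_bool (i = y) * (of_bool (j = x) * - (?R a i * ?R' j b))"
      by simp
  qed
  also have "\<dots> = (\<Sum>i<n. of_bool (i = x) * (\<Sum>j<n. of_bool (j = y) * - (?R a i * ?R' j b)))
      + (\<Sum>i<n. of_bool (i = y) * (\<Sum>j<n. of_bool (j = x) * - (?R a i * ?R' j b)))"
    by (simp only: sum.distrib sum_distrib_left)
  also have "\<dots> = - (?R a x * ?R' y b + ?R a y * ?R' x b)"
    using xy by (simp only: sum_of_bool_collapse) simp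
  finally show ?thesis .
qed

lemma resolvent_edge_perturbation_le:
  assumes "sym_on n M" "sym_on n M'" and z: "Im z > 0" and ab: "a < n" "b < n"
    and xy: "x < n" "y < n" "x \<noteq> y"
    and "\<And>i j. i < n \<Longrightarrow> j < n \<Longrightarrow> M i j - M' i j = of_bool ({i, j} = {x, y})"
  shows "norm (resolvent n M z a b - resolvent n M' z a b) \<le> 2 / (Im z)\<^sup>2"
proof -
  have *: "norm (resolvent n M z a i * resolvent n M' z j b) \<le> 1 / (Im z)\<^sup>2" if "i < n" "j < n" for i j
  proof -
    have "norm (resolvent n M z a i * resolvent n M' z j b) \<le> (1 / Im z) * (1 / Im z)"
      unfolding norm_mult using assms that z by (intro mult_mono norm_resolvent_le) auto
    thus ?thesis by (simp add: power2_eq_square)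
  qed
  have "norm (resolvent n M z a b - resolvent n M' z a b) \<le>
     norm (resolvent n M z a x * resolvent n M' z y b) + norm (resolvent n M z a y * resolvent n M' z x b)"
    using norm_triangle_ineq by (simp only: resolvent_edge_perturbation[OF assms] norm_minus_cancel)
  also have "\<dots> \<le> 1 / (Im z)\<^sup>2 + 1 / (Im z)\<^sup>2"
    using xy by (intro add_mono *)
  finally show ?thesis by simp
qed

text \<open>The change of the trace is a sum over \<open>a\<close> of products of an entry of column \<open>x\<close> with an entry of
  row \<open>y\<close> (and vice versa), so Cauchy--Schwarz and the row bound make it independent of \<open>n\<close>.\<close>

lemma resolvent_trace_edge_perturbation_le:
  assumes M: "sym_on n M" "sym_on n M'" and z: "Im z > 0"
    and xy: "x < n" "y < n" "x \<noteq> y"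
    and D: "\<And>i j. i < n \<Longrightarrow> j < n \<Longrightarrow> M i j - M' i j = of_bool ({i, j} = {x, y})"
  shows "norm ((\<Sum>a<n. resolvent n M z a a) - (\<Sum>a<n. resolvent n M' z a a)) \<le> 2 / (Im z)\<^sup>2"
proof -
  let ?R = "resolvent n M z" and ?R' = "resolvent n M' z"
  have *: "(\<Sum>a<n. norm (?R a x * ?R' y a)) \<le> 1 / (Im z)\<^sup>2" if "x < n" "y < n" for x y
  proof -
    have "(\<Sum>a<n. norm (?R a x * ?R' y a)) \<le> (\<Sum>a<n. ((norm (?R x a))\<^sup>2 + (norm (?R' y a))\<^sup>2) / 2)"
    proof (intro sum_mono)
      fix a
      show "norm (?R a x * ?R' y a) \<le> ((norm (?R x a))\<^sup>2 + (norm (?R' y a))\<^sup>2) / 2"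
        using sum_squares_bound[of "norm (?R x a)" "norm (?R' y a)"]
        by (simp add: norm_mult resolvent_sym[of n M z a x])
    qed
    also have "\<dots> \<le> (1 / (Im z)\<^sup>2 + 1 / (Im z)\<^sup>2) / 2"
      unfolding sum_divide_distrib[symmetric] sum.distrib
      using M z that by (intro divide_right_mono add_mono resolvent_row_norm) auto
    finally show ?thesis by simp
  qed
  have "norm ((\<Sum>a<n. ?R a a) - (\<Sum>a<n. ?R' a a)) = norm (\<Sum>a<n. - (?R a x * ?R' y a + ?R a y * ?R' x a))"
    unfolding sum_subtractf[symmetric]
    using resolvent_edge_perturbation[OF M z _ _ xy D] by (intro arg_cong[where f = norm] sum.cong) auto
  also have "\<dots> \<le> (\<Sum>a<n. norm (?R a x * ?R' y a) + norm (?R a y * ?R' x a))"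
    by (intro sum_norm_le) (metis norm_minus_cancel norm_triangle_ineq)
  also have "\<dots> \<le> 1 / (Im z)\<^sup>2 + 1 / (Im z)\<^sup>2"
    unfolding sum.distrib using xy by (intro add_mono *)
  finally show ?thesis by simp
qed

section \<open>Random subsets and the Efron--Stein inequality\<close>

text \<open>For \<open>A = all_edges n\<close> this is the random graph model; an arbitrary ground set allows induction on
  \<open>A\<close>.\<close>

definition random_subset :: "'a set \<Rightarrow> real \<Rightarrow> 'a set pmf" where
  "random_subset A p = map_pmf (\<lambda>f. {e \<in> A. f e}) (Pi_pmf A False (\<lambda>_. bernoulli_pmf p))"

definition avg :: "'a set \<Rightarrow> real \<Rightarrow> ('a set \<Rightarrow> 'b::{banach, second_countable_topology}) \<Rightarrow> 'b" where
  "avg A p F = measure_pmf.expectation (random_subset A p) F"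

lemma set_random_subset: "set_pmf (random_subset A p) \<subseteq> Pow A"
  by (auto simp: random_subset_def)

lemma finite_random_subset: "finite A \<Longrightarrow> finite (set_pmf (random_subset A p))"
  by (rule finite_subset[OF set_random_subset]) simp

lemma integrable_random_subset:
  fixes F :: "'a set \<Rightarrow> 'b::{banach, second_countable_topology}"
  shows "finite A \<Longrightarrow> integrable (random_subset A p) F"
  by (rule integrable_measure_pmf_finite[OF finite_random_subset])

lemma random_subset_insert:
  assumes "finite A" "a \<notin> A"
  shows "random_subset (insert a A) p =
    bind_pmf (bernoulli_pmf p) (\<lambda>b. map_pmf (\<lambda>S. if b then insert a S else S) (random_subset A p))"
proof -
  have *: "{e \<in> insert a A. (f(a := y)) e} = (if y then insert a {e \<in> A. f e} else {e \<in> A. f e})" for f y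
    using assms(2) by auto
  show ?thesis
    unfolding random_subset_def Pi_pmf_insert'[OF assms]
    by (simp only: map_pmf_def bind_assoc_pmf bind_return_pmf *)
qed

context
  fixes A :: "'a set"
  assumes fin: "finite A"
begin

lemma avg_insert:
  assumes "a \<notin> A" "0 \<le> p" "p \<le> 1"
  shows "avg (insert a A) p F = p *\<^sub>R avg A p (\<lambda>S. F (insert a S)) + (1 - p) *\<^sub>R avg A p F"
  unfolding avg_def random_subset_insert[OF fin assms(1)]
  by (subst pmf_expectation_bind[of UNIV])
     (use assms in \<open>auto simp: finite_random_subset[OF fin] UNIV_bool\<close>)

lemma avg_add: "avg A p (\<lambda>S. F S + G S) = avg A p F + avg A p G"
  and avg_diff: "avg A p (\<lambda>S. F S - G S) = avg A p F - avg A p G"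
  and avg_scaleR: "avg A p (\<lambda>S. c *\<^sub>R F S) = c *\<^sub>R avg A p F"
  and avg_sum: "avg A p (\<lambda>S. \<Sum>i\<in>I. H i S) = (\<Sum>i\<in>I. avg A p (H i))"
  and avg_const: "avg A p (\<lambda>_. b) = b"
  unfolding avg_def by (simp_all add: integrable_random_subset fin)

lemma avg_cmult: "avg A p (\<lambda>S. (c::'b::{real_normed_field,banach,second_countable_topology}) * F S) = c * avg A p F"
  unfolding avg_def by (simp add: integrable_random_subset fin)

lemma avg_cong: "(\<And>S. S \<subseteq> A \<Longrightarrow> F S = G S) \<Longrightarrow> avg A p F = avg A p G"
  unfolding avg_def using set_random_subset[of A p]
  by (intro integral_cong_AE) (auto simp: AE_measure_pmf_iff)

lemma avg_mono: "(\<And>S. S \<subseteq> A \<Longrightarrow> F S \<le> (G S :: real)) \<Longrightarrow> avg A p F \<le> avg A p G"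
  unfolding avg_def using set_random_subset[of A p]
  by (intro integral_mono_AE) (auto simp: AE_measure_pmf_iff integrable_random_subset fin)

lemma avg_nonneg: "(\<And>S. S \<subseteq> A \<Longrightarrow> 0 \<le> (F S :: real)) \<Longrightarrow> 0 \<le> avg A p F"
  using avg_mono[of "\<lambda>_. 0" F] by (simp add: avg_const)

lemma norm_avg_le: "norm (avg A p F) \<le> avg A p (\<lambda>S. norm (F S))"
  unfolding avg_def by (rule integral_norm_bound)

lemma avg_bounded_linear: "bounded_linear h \<Longrightarrow> avg A p (\<lambda>S. h (F S)) = h (avg A p F)"
  unfolding avg_def by (intro integral_bounded_linear integrable_random_subset fin)

lemma norm_avg_bound:
  assumes "\<And>S. S \<subseteq> A \<Longrightarrow> norm (F S) \<le> b"
  shows "norm (avg A p F) \<le> b"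
proof -
  have "norm (avg A p F) \<le> avg A p (\<lambda>S. norm (F S))" by (rule norm_avg_le)
  also have "\<dots> \<le> avg A p (\<lambda>_. b)" by (rule avg_mono) (rule assms)
  finally show ?thesis by (simp add: avg_const)
qed

lemma variance_eq:
  fixes F :: "'a set \<Rightarrow> 'b::euclidean_space"
  shows "avg A p (\<lambda>S. (norm (F S - m))\<^sup>2) = avg A p (\<lambda>S. (norm (F S))\<^sup>2) - 2 * (avg A p F \<bullet> m) + (norm m)\<^sup>2"
proof -
  have "avg A p (\<lambda>S. (norm (F S - m))\<^sup>2) = avg A p (\<lambda>S. (norm (F S))\<^sup>2 - 2 *\<^sub>R (F S \<bullet> m) + (norm m)\<^sup>2)"
    by (rule avg_cong) (simp add: power2_norm_eq_inner inner_diff_left inner_diff_right inner_commute)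
  also have "\<dots> = avg A p (\<lambda>S. (norm (F S))\<^sup>2) - 2 * (avg A p F \<bullet> m) + (norm m)\<^sup>2"
    by (simp only: avg_add avg_diff avg_scaleR avg_const avg_bounded_linear[OF bounded_linear_inner_left]) simp
  finally show ?thesis .
qed

lemma avg_square_le:
  fixes F :: "'a set \<Rightarrow> real"
  shows "(avg A p F)\<^sup>2 \<le> avg A p (\<lambda>S. (F S)\<^sup>2)"
proof -
  have "0 \<le> avg A p (\<lambda>S. (norm (F S - avg A p F))\<^sup>2)" by (rule avg_nonneg) simp
  thus ?thesis unfolding variance_eq by (simp add: power2_eq_square)
qed

end

text \<open>Resampling the single element \<open>e\<close> does not change the law of the random subset.\<close>

lemma avg_resample:
  assumes "finite A" "e \<in> A" "0 \<le> p" "p \<le> 1"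
  shows "avg A p F = p *\<^sub>R avg A p (\<lambda>S. F (insert e S)) + (1 - p) *\<^sub>R avg A p (\<lambda>S. F (S - {e}))"
proof -
  define B where "B = A - {e}"
  have B: "finite B" "e \<notin> B" "A = insert e B" using assms by (auto simp: B_def)
  have i: "avg A p G = p *\<^sub>R avg B p (\<lambda>S. G (insert e S)) + (1 - p) *\<^sub>R avg B p G" for G :: "'a set \<Rightarrow> 'b"
    unfolding B(3) by (rule avg_insert[OF B(1,2) assms(3,4)])
  have "avg A p (\<lambda>S. F (insert e S)) = avg B p (\<lambda>S. F (insert e S))"
    unfolding i by (simp add: scaleR_left_diff_distrib)
  moreover have "avg A p (\<lambda>S. F (S - {e})) = avg B p F"
  proof -
    have "avg B p (\<lambda>S. F (S - {e})) = avg B p F"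
      using B by (intro avg_cong) (auto intro!: arg_cong[where f = F])
    thus ?thesis unfolding i by (simp add: scaleR_left_diff_distrib)
  qed
  ultimately show ?thesis unfolding i[of F] by simp
qed

text \<open>The discrete counterpart of Gaussian integration by parts: correlating \<open>F\<close> with the centred
  indicator of \<open>e\<close> measures how \<open>F\<close> changes when \<open>e\<close> is switched on.\<close>

lemma avg_centered_indicator:
  assumes "finite A" "e \<in> A" "0 \<le> p" "p \<le> 1"
  shows "avg A p (\<lambda>S. (of_bool (e \<in> S) - p) *\<^sub>R F S) =
     (p * (1 - p)) *\<^sub>R avg A p (\<lambda>S. F (insert e S) - F (S - {e}))"
proof -
  have "avg A p (\<lambda>S. (of_bool (e \<in> S) - p) *\<^sub>R F S) =
      p *\<^sub>R avg A p (\<lambda>S. (1 - p) *\<^sub>R F (insert e S)) + (1 - p) *\<^sub>R avg A p (\<lambda>S. (- p) *\<^sub>R F (S - {e}))"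
    by (subst avg_resample[OF assms]) simp
  also have "\<dots> = (p * (1 - p)) *\<^sub>R (avg A p (\<lambda>S. F (insert e S)) - avg A p (\<lambda>S. F (S - {e})))"
    unfolding avg_scaleR[OF assms(1)] by (simp only: scaleR_scaleR scaleR_right_diff_distrib) (simp add: mult.commute)
  finally show ?thesis unfolding avg_diff[OF assms(1)] .
qed

lemma avg_indicator:
  assumes "finite A" "e \<in> A" "0 \<le> p" "p \<le> 1"
  shows "avg A p (\<lambda>S. of_bool (e \<in> S) * F S) = p * (avg A p (\<lambda>S. F (insert e S)) :: real)"
  by (subst avg_resample[OF assms]) (simp add: avg_const[OF assms(1)])

lemma norm_convex_comb:
  fixes X Y :: "'b::real_inner"
  shows "p * (norm X)\<^sup>2 + (1 - p) * (norm Y)\<^sup>2 - (norm (p *\<^sub>R X + (1 - p) *\<^sub>R Y))\<^sup>2 = p * (1 - p) * (norm (X - Y))\<^sup>2"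
  unfolding power2_norm_eq_inner inner_add_left inner_add_right inner_diff_left inner_diff_right
    inner_scaleR_left inner_scaleR_right inner_commute[of Y X]
  by (simp add: algebra_simps)

text \<open>Bounded differences bound the variance. Induction on the ground set: conditioning on
  whether \<open>a\<close> is present splits the variance into the mean of the two conditional variances, covered by the
  induction hypothesis, and the variance \<open>p (1 - p) |X - Y|\<^sup>2\<close> of the conditional mean. Values in
  a Euclidean space include the complex-valued case needed for resolvent traces.\<close>

theorem efron_stein:
  fixes F :: "'a set \<Rightarrow> 'b::euclidean_space"
  assumes "finite A" and p: "0 \<le> p" "p \<le> 1"
    and "\<And>S e. S \<subseteq> A \<Longrightarrow> e \<in> A \<Longrightarrow> norm (F (insert e S) - F (S - {e})) \<le> c e"
  shows "avg A p (\<lambda>S. (norm (F S - avg A p F))\<^sup>2) \<le> (\<Sum>e\<in>A. (c e)\<^sup>2)"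
proof -
  have "avg A p (\<lambda>S. (norm (F S))\<^sup>2) - (norm (avg A p F))\<^sup>2 \<le> (\<Sum>e\<in>A. (c e)\<^sup>2)"
    using assms(1,4)
  proof (induction A arbitrary: F rule: finite_induct)
    case empty
    have *: "avg {} p G = G {}" for G :: "'a set \<Rightarrow> 'c::{banach, second_countable_topology}"
    proof -
      have "avg {} p G = avg {} p (\<lambda>_::'a set. G {})" by (rule avg_cong) auto
      thus ?thesis using avg_const[of "{}" p "G {}"] by simp
    qed
    show ?case by (simp add: *)
  next
    case (insert a A F)
    define X where "X = avg A p (\<lambda>S. F (insert a S))"
    define Y where "Y = avg A p F"
    have "avg A p (\<lambda>S. (norm (F (insert a S)))\<^sup>2) - (norm X)\<^sup>2 \<le> (\<Sum>e\<in>A. (c e)\<^sup>2)"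
      unfolding X_def
    proof (rule insert.IH)
      fix S e assume S: "S \<subseteq> A" "e \<in> A"
      hence "insert a (S - {e}) = insert a S - {e}" using insert.hyps(2) by auto
      thus "norm (F (insert a (insert e S)) - F (insert a (S - {e}))) \<le> c e"
        using insert.prems[of "insert a S" e] S by (auto simp: insert_commute[of a e])
    qed
    moreover have "avg A p (\<lambda>S. (norm (F S))\<^sup>2) - (norm Y)\<^sup>2 \<le> (\<Sum>e\<in>A. (c e)\<^sup>2)"
      unfolding Y_def using insert.prems by (intro insert.IH) auto
    moreover have XY: "p * (1 - p) * (norm (X - Y))\<^sup>2 \<le> (c a)\<^sup>2"
    proof -
      have "norm (X - Y) \<le> c a"
        unfolding X_def Y_def avg_diff[OF insert.hyps(1), symmetric]
      proof (rule norm_avg_bound[OF insert.hyps(1)])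
        fix S assume "S \<subseteq> A"
        hence "S \<subseteq> insert a A" "S - {a} = S" using insert.hyps(2) by auto
        thus "norm (F (insert a S) - F S) \<le> c a"
          using insert.prems[of S a] by simp
      qed
      hence "(norm (X - Y))\<^sup>2 \<le> (c a)\<^sup>2" by (intro power_mono) auto
      moreover have "p * (1 - p) \<le> 1" using p mult_le_one[of p "1 - p"] by auto
      moreover have "p * (1 - p) * (norm (X - Y))\<^sup>2 \<le> (norm (X - Y))\<^sup>2"
        using p calculation(2) by (intro mult_left_le_one_le) auto
      ultimately show ?thesis by linarith
    qed
    ultimately have *: "avg A p (\<lambda>S. (norm (F (insert a S)))\<^sup>2) \<le> (norm X)\<^sup>2 + (\<Sum>e\<in>A. (c e)\<^sup>2)"
      "avg A p (\<lambda>S. (norm (F S))\<^sup>2) \<le> (norm Y)\<^sup>2 + (\<Sum>e\<in>A. (c e)\<^sup>2)" by auto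
    have "avg (insert a A) p (\<lambda>S. (norm (F S))\<^sup>2) - (norm (avg (insert a A) p F))\<^sup>2 =
       p * avg A p (\<lambda>S. (norm (F (insert a S)))\<^sup>2) + (1 - p) * avg A p (\<lambda>S. (norm (F S))\<^sup>2)
         - (norm (p *\<^sub>R X + (1 - p) *\<^sub>R Y))\<^sup>2"
      by (simp add: avg_insert[OF insert.hyps p] X_def Y_def)
    also have "\<dots> \<le> p * ((norm X)\<^sup>2 + (\<Sum>e\<in>A. (c e)\<^sup>2)) + (1 - p) * ((norm Y)\<^sup>2 + (\<Sum>e\<in>A. (c e)\<^sup>2))
         - (norm (p *\<^sub>R X + (1 - p) *\<^sub>R Y))\<^sup>2"
      using p by (intro diff_right_mono add_mono mult_left_mono *) auto
    also have "\<dots> = (\<Sum>e\<in>A. (c e)\<^sup>2) + p * (1 - p) * (norm (X - Y))\<^sup>2"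
      unfolding norm_convex_comb[symmetric] by (simp add: algebra_simps)
    also have "\<dots> \<le> (\<Sum>e\<in>insert a A. (c e)\<^sup>2)"
      using XY insert.hyps by simp
    finally show ?case .
  qed
  thus ?thesis
    unfolding variance_eq[OF assms(1)] by (simp add: power2_norm_eq_inner)
qed

lemma finite_all_edges: "finite (all_edges n)"
  by (rule finite_subset[of _ "Pow {..<n}"]) (auto simp: all_edges_def)

lemma card_all_edges_le: "card (all_edges n) \<le> n\<^sup>2"
proof -
  have "all_edges n \<subseteq> (\<lambda>(i, j). {i, j}) ` ({..<n} \<times> {..<n})"
    by (auto simp: all_edges_def card_2_iff image_iff)
  hence "card (all_edges n) \<le> card ({..<n} \<times> {..<n})"
    by (meson card_image_le card_mono finite_SigmaI finite_imageI finite_lessThan order_trans)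
  thus ?thesis by (simp add: power2_eq_square)
qed

lemma edge_in_all_edges: "x < n \<Longrightarrow> y < n \<Longrightarrow> x \<noteq> y \<Longrightarrow> {x, y} \<in> all_edges n"
  by (auto simp: all_edges_def)

lemma gnp_eq_random_subset: "gnp n p = random_subset (all_edges n) p"
  by (simp add: gnp_def random_subset_def)

section \<open>The self-consistent equation for the mean resolvent trace\<close>

text \<open>The centred adjacency matrix. Its entries above the diagonal are independent with variance
  \<open>p * (1 - p)\<close>.\<close>

definition wigner :: "real \<Rightarrow> edge_set \<Rightarrow> nat \<Rightarrow> nat \<Rightarrow> real" where
  "wigner p E i j = (if i = j then 0 else of_bool ({i, j} \<in> E) - p)"

definition resolvent_trace :: "nat \<Rightarrow> (nat \<Rightarrow> nat \<Rightarrow> real) \<Rightarrow> complex \<Rightarrow> complex" where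
  "resolvent_trace n M z = (\<Sum>a<n. resolvent n M z a a)"

lemma sym_wigner: "sym_on n (wigner p E)"
  by (auto simp: sym_on_def wigner_def insert_commute)

lemma wigner_flip:
  "x \<noteq> y \<Longrightarrow> wigner p (insert {x, y} E) i j - wigner p (E - {{x, y}}) i j = of_bool ({i, j} = {x, y})"
  by (auto simp: wigner_def)

lemma all_edgesE:
  assumes "e \<in> all_edges n"
  obtains x y where "e = {x, y}" "x < n" "y < n" "x \<noteq> y"
  using assms by (auto simp: all_edges_def card_2_iff)

text \<open>Of the two graphs with \<open>{x, y}\<close> inserted and deleted, one is \<open>E\<close> itself. Hence
  only one factor changes, and by at most \<open>2 / (Im z)\<^sup>2\<close>.\<close>

lemma resolvent_product_flip:
  fixes p :: real and n x y :: nat and E :: edge_set and z :: complex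
  defines "R \<equiv> \<lambda>E. resolvent n (wigner p E) z"
  defines "E1 \<equiv> insert {x, y} E" and "E0 \<equiv> E - {{x, y}}"
  assumes z: "Im z > 0" and xy: "x < n" "y < n" "x \<noteq> y" and ab: "a < n" "b < n" "c < n" "d < n"
  shows "norm (R E a b * R E c d - R E1 a b * R E0 c d) \<le> 2 / (Im z)^3"
proof -
  have d: "norm (R E1 i j - R E0 i j) \<le> 2 / (Im z)\<^sup>2" if "i < n" "j < n" for i j
    unfolding R_def E1_def E0_def
    by (intro resolvent_edge_perturbation_le[OF sym_wigner sym_wigner z that xy] wigner_flip xy)
  have b: "norm (R E i j) \<le> 1 / Im z" if "i < n" "j < n" for E i j
    unfolding R_def by (intro norm_resolvent_le sym_wigner z that)
  have *: "1 / Im z * (2 / (Im z)\<^sup>2) = 2 / (Im z)^3" "2 / (Im z)\<^sup>2 * (1 / Im z) = 2 / (Im z)^3"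
    by (simp_all add: power2_eq_square power3_eq_cube)
  show ?thesis
  proof (cases "{x, y} \<in> E")
    case True
    hence "E1 = E" by (auto simp: E1_def)
    hence "norm (R E a b * R E c d - R E1 a b * R E0 c d) = norm (R E a b) * norm (R E1 c d - R E0 c d)"
      by (simp flip: norm_mult right_diff_distrib)
    also have "\<dots> \<le> 1 / Im z * (2 / (Im z)\<^sup>2)" using z ab by (intro mult_mono b d) auto
    finally show ?thesis unfolding * .
  next
    case False
    hence "E0 = E" by (auto simp: E0_def)
    hence "norm (R E a b * R E c d - R E1 a b * R E0 c d) = norm (R E1 a b - R E0 a b) * norm (R E c d)"
      by (simp add: norm_minus_commute flip: norm_mult left_diff_distrib)
    also have "\<dots> \<le> 2 / (Im z)\<^sup>2 * (1 / Im z)" using z ab by (intro mult_mono b d) auto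
    finally show ?thesis unfolding * .
  qed
qed

text \<open>The trace of \<open>(W - z) R = 1\<close> reads \<open>\<Sum>x y. W x y * R x y = n + z * tr R\<close>. Taking means and
  integrating by parts in every edge turns the left side into \<open>- q * avg (\<Sum>x y. R x x * R y y + R x y * R x y)\<close>, up to
  the error of replacing the resolvents of the flipped graphs by \<open>R\<close>. Here \<open>\<Sum>x y. R x x * R y y = (tr R)\<^sup>2\<close>, the
  squared entries are negligible by the row bound, and the Efron--Stein inequality allows the mean of \<open>(tr R)\<^sup>2\<close> to be
  replaced by the square of the mean.\<close>

theorem self_consistent_equation:
  fixes p :: real and n :: nat and z :: complex
  assumes p: "0 \<le> p" "p \<le> 1" and z: "Im z > 0"
  defines "m \<equiv> avg (all_edges n) p (\<lambda>E. resolvent_trace n (wigner p E) z)"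
  defines "q \<equiv> p * (1 - p)"
  shows "norm (of_nat n + z * m + of_real q * m\<^sup>2) \<le>
    q * (4 * (real n)\<^sup>2 / (Im z)^3 + 3 * real n / (Im z)\<^sup>2 + 4 * (real n)\<^sup>2 / (Im z)^4)"
proof -
  define A where "A = all_edges n"
  define R where "R = (\<lambda>E. resolvent n (wigner p E) z)"
  define T where "T = (\<lambda>E. resolvent_trace n (wigner p E) z)"
  let ?v = "Im z"
  have fin: "finite A" by (simp add: A_def finite_all_edges)
  have q: "0 \<le> q" using p by (simp add: q_def)
  have b: "norm (R E i j) \<le> 1 / Im z" if "i < n" "j < n" for E i j
    unfolding R_def by (intro norm_resolvent_le sym_wigner z that)
  have Rs: "R E i j = R E j i" for E i j unfolding R_def by (rule resolvent_sym)
  have off: "norm (avg A p (\<lambda>E. of_real (wigner p E x y) * R E x y) +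
      q *\<^sub>R avg A p (\<lambda>E. R E x x * R E y y + R E x y * R E x y)) \<le> q * (4 / ?v^3)"
    if xy: "x < n" "y < n" "x \<noteq> y" for x y
  proof -
    have e: "{x, y} \<in> A" unfolding A_def by (rule edge_in_all_edges[OF xy])
    let ?E1 = "\<lambda>E. insert {x, y} E" and ?E0 = "\<lambda>E. E - {{x, y}}"
    have "avg A p (\<lambda>E. of_real (wigner p E x y) * R E x y) =
        avg A p (\<lambda>E. (of_bool ({x, y} \<in> E) - p) *\<^sub>R R E x y)"
      using xy(3) by (simp add: wigner_def scaleR_conv_of_real)
    also have "\<dots> = q *\<^sub>R avg A p (\<lambda>E. R (?E1 E) x y - R (?E0 E) x y)"
      unfolding q_def by (rule avg_centered_indicator[OF fin e p])
    also have "\<dots> = q *\<^sub>R avg A p (\<lambda>E. - (R (?E1 E) x x * R (?E0 E) y y + R (?E1 E) x y * R (?E0 E) x y))"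
      unfolding R_def
      by (subst resolvent_edge_perturbation[OF sym_wigner sym_wigner z xy(1,2) xy wigner_flip[OF xy(3)]]) simp
    finally have W: "avg A p (\<lambda>E. of_real (wigner p E x y) * R E x y) =
      q *\<^sub>R avg A p (\<lambda>E. - (R (?E1 E) x x * R (?E0 E) y y + R (?E1 E) x y * R (?E0 E) x y))" .
    have eq: "avg A p (\<lambda>E. of_real (wigner p E x y) * R E x y) +
      q *\<^sub>R avg A p (\<lambda>E. R E x x * R E y y + R E x y * R E x y) =
      q *\<^sub>R avg A p (\<lambda>E. (R E x x * R E y y - R (?E1 E) x x * R (?E0 E) y y) + (R E x y * R E x y - R (?E1 E) x y * R (?E0 E) x y))"
      unfolding W scaleR_add_right[symmetric] avg_add[OF fin, symmetric]
      by (intro arg_cong2[where f = scaleR] refl avg_cong[OF fin]) (simp add: algebra_simps)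
    have "norm (avg A p (\<lambda>E. of_real (wigner p E x y) * R E x y) +
      q *\<^sub>R avg A p (\<lambda>E. R E x x * R E y y + R E x y * R E x y)) =
      q * norm (avg A p (\<lambda>E. (R E x x * R E y y - R (?E1 E) x x * R (?E0 E) y y) + (R E x y * R E x y - R (?E1 E) x y * R (?E0 E) x y)))"
      unfolding eq using q by simp
    also have "\<dots> \<le> q * (4 / ?v^3)"
    proof (intro mult_left_mono q norm_avg_bound[OF fin])
      fix E
      have flip: "norm (R E a b * R E c d - R (?E1 E) a b * R (?E0 E) c d) \<le> 2 / ?v^3"
        if "a < n" "b < n" "c < n" "d < n" for a b c d
        unfolding R_def by (rule resolvent_product_flip[OF z xy that])
      have *: "4 / ?v^3 = 2 / ?v^3 + 2 / ?v^3" by simp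
      show "norm ((R E x x * R E y y - R (?E1 E) x x * R (?E0 E) y y) + (R E x y * R E x y - R (?E1 E) x y * R (?E0 E) x y)) \<le> 4 / ?v^3"
        unfolding * by (rule norm_triangle_mono[OF flip flip]) (use xy in auto)
    qed
    finally show ?thesis .
  qed
  \<comment> \<open>A loop entry vanishes in \<open>W\<close>, so on the diagonal only the added term has to be bounded.\<close>
  have entry: "norm (avg A p (\<lambda>E. of_real (wigner p E x y) * R E x y) +
      q *\<^sub>R avg A p (\<lambda>E. R E x x * R E y y + R E x y * R E x y)) \<le> q * (4 / ?v^3) + of_bool (x = y) * (q * (2 / ?v\<^sup>2))"
    if xy: "x < n" "y < n" for x y
  proof (cases "x = y")
    case True
    have "norm (avg A p (\<lambda>E. R E x x * R E y y + R E x y * R E x y)) \<le> 2 / ?v\<^sup>2"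
    proof (rule norm_avg_bound[OF fin])
      fix E
      have "norm (R E i j * R E k l) \<le> 1 / ?v * (1 / ?v)" if "i < n" "j < n" "k < n" "l < n" for i j k l
        unfolding norm_mult using z that by (intro mult_mono b) auto
      hence "norm (R E x x * R E y y + R E x y * R E x y) \<le> 1 / ?v * (1 / ?v) + 1 / ?v * (1 / ?v)"
        using xy by (intro norm_triangle_mono) auto
      thus "norm (R E x x * R E y y + R E x y * R E x y) \<le> 2 / ?v\<^sup>2" by (simp add: power2_eq_square)
    qed
    moreover have "0 \<le> q * (4 / ?v^3)" using q z by simp
    ultimately have "q * norm (avg A p (\<lambda>E. R E x x * R E y y + R E x y * R E x y)) \<le> q * (4 / ?v^3) + q * (2 / ?v\<^sup>2)"
      using mult_left_mono[OF _ q] by fastforce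
    thus ?thesis using True q by (simp add: wigner_def avg_const[OF fin])
  next
    case False
    thus ?thesis using off[OF xy] by simp
  qed
  have trace_id: "(\<Sum>x<n. \<Sum>y<n. of_real (wigner p E x y) * R E x y) = of_nat n + z * T E" for E
  proof -
    have "(\<Sum>x<n. \<Sum>y<n. (of_real (wigner p E x y) - z * of_bool (x = y)) * R E y x) = of_nat n"
      unfolding R_def using resolvent_inverse[OF sym_wigner z] by simp
    moreover have "(\<Sum>x<n. \<Sum>y<n. (of_real (wigner p E x y) - z * of_bool (x = y)) * R E y x) =
       (\<Sum>x<n. \<Sum>y<n. of_real (wigner p E x y) * R E x y) - (\<Sum>x<n. z * (\<Sum>y<n. of_bool (x = y) * R E x y))"
      unfolding sum_subtractf[symmetric] sum_distrib_left
      by (intro sum.cong refl) (simp add: Rs[of E] algebra_simps)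
    moreover have "(\<Sum>x<n. z * (\<Sum>y<n. of_bool (x = y) * R E x y)) = z * T E"
      unfolding T_def resolvent_trace_def R_def sum_distrib_left[symmetric]
      by (intro arg_cong2[where f = "(*)"] refl sum.cong) (simp only: sum_of_bool_collapse lessThan_iff)
    ultimately show ?thesis by (simp add: algebra_simps)
  qed
  \<comment> \<open>The part of the double sum that is negligible against the square of the trace.\<close>
  define Q where "Q = (\<lambda>E. \<Sum>x<n. \<Sum>y<n. R E x y * R E x y)"
  have prod_id: "(\<Sum>x<n. \<Sum>y<n. R E x x * R E y y + R E x y * R E x y) = (T E)\<^sup>2 + Q E" for E
    by (simp add: Q_def T_def resolvent_trace_def R_def power2_eq_square sum_product sum.distrib)
  have Q: "norm (avg A p Q) \<le> real n / ?v\<^sup>2"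
  proof (rule norm_avg_bound[OF fin])
    fix E
    have "norm (Q E) \<le> (\<Sum>x<n. \<Sum>y<n. (norm (R E x y))\<^sup>2)"
      unfolding Q_def by (intro sum_norm_le order_refl) (simp add: norm_mult power2_eq_square)
    also have "\<dots> \<le> (\<Sum>x<n. 1 / ?v\<^sup>2)"
      unfolding R_def by (intro sum_mono resolvent_row_norm sym_wigner z) auto
    finally show "norm (Q E) \<le> real n / ?v\<^sup>2" by simp
  qed
  have T: "avg A p T = m" by (simp add: A_def T_def m_def)
  have main: "norm (of_nat n + z * m + q *\<^sub>R (avg A p (\<lambda>E. (T E)\<^sup>2) + avg A p Q)) \<le>
     q * (4 * (real n)\<^sup>2 / ?v^3) + q * (2 * real n / ?v\<^sup>2)"
  proof -
    have eq: "of_nat n + z * m + q *\<^sub>R (avg A p (\<lambda>E. (T E)\<^sup>2) + avg A p Q) =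
      (\<Sum>x<n. \<Sum>y<n. avg A p (\<lambda>E. of_real (wigner p E x y) * R E x y) +
      q *\<^sub>R avg A p (\<lambda>E. R E x x * R E y y + R E x y * R E x y))"
    proof -
      have "(\<Sum>x<n. \<Sum>y<n. avg A p (\<lambda>E. of_real (wigner p E x y) * R E x y)) = avg A p (\<lambda>E. of_nat n + z * T E)"
        unfolding trace_id[symmetric] avg_sum[OF fin] ..
      also have "\<dots> = of_nat n + z * m" by (simp add: avg_add[OF fin] avg_cmult[OF fin] avg_const[OF fin] T)
      finally have 1: "(\<Sum>x<n. \<Sum>y<n. avg A p (\<lambda>E. of_real (wigner p E x y) * R E x y)) = of_nat n + z * m" .
      have "(\<Sum>x<n. \<Sum>y<n. avg A p (\<lambda>E. R E x x * R E y y + R E x y * R E x y)) = avg A p (\<lambda>E. (T E)\<^sup>2 + Q E)"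
        unfolding prod_id[symmetric] avg_sum[OF fin] ..
      hence 2: "(\<Sum>x<n. \<Sum>y<n. avg A p (\<lambda>E. R E x x * R E y y + R E x y * R E x y)) = avg A p (\<lambda>E. (T E)\<^sup>2) + avg A p Q"
        unfolding avg_add[OF fin] .
      show ?thesis unfolding sum.distrib 1 scaleR_sum_right[symmetric] 2 ..
    qed
    have "norm (of_nat n + z * m + q *\<^sub>R (avg A p (\<lambda>E. (T E)\<^sup>2) + avg A p Q))
       \<le> (\<Sum>x<n. \<Sum>y<n. q * (4 / ?v^3) + of_bool (x = y) * (q * (2 / ?v\<^sup>2)))"
      unfolding eq using entry by (intro sum_norm_le) auto
    also have "\<dots> = (\<Sum>x<n. \<Sum>y<n. q * (4 / ?v^3)) + (\<Sum>x<n. q * (2 / ?v\<^sup>2))"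
      unfolding sum.distrib
      by (intro arg_cong2[where f = "(+)"] refl sum.cong) (simp only: sum_of_bool_collapse lessThan_iff)
    also have "\<dots> = q * (4 * (real n)\<^sup>2 / ?v^3) + q * (2 * real n / ?v\<^sup>2)"
      by (simp add: power2_eq_square mult_ac)
    finally show ?thesis .
  qed
  have var: "norm (avg A p (\<lambda>E. (T E)\<^sup>2) - m\<^sup>2) \<le> 4 * (real n)\<^sup>2 / ?v^4"
  proof -
    have eq: "avg A p (\<lambda>E. (T E)\<^sup>2) - m\<^sup>2 = avg A p (\<lambda>E. (T E - m)\<^sup>2)"
    proof -
      have "avg A p (\<lambda>E. (T E - m)\<^sup>2) = avg A p (\<lambda>E. (T E)\<^sup>2 - 2 * m * T E + m\<^sup>2)"
        by (simp add: power2_diff algebra_simps)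
      also have "\<dots> = avg A p (\<lambda>E. (T E)\<^sup>2) - 2 * m * m + m\<^sup>2"
        by (simp only: avg_add[OF fin] avg_diff[OF fin] avg_cmult[OF fin] avg_const[OF fin] T)
      finally show ?thesis by (simp add: power2_eq_square)
    qed
    have "norm (avg A p (\<lambda>E. (T E)\<^sup>2) - m\<^sup>2) \<le> avg A p (\<lambda>E. (norm (T E - avg A p T))\<^sup>2)"
      unfolding eq using norm_avg_le[OF fin, of p "\<lambda>E. (T E - m)\<^sup>2"] by (simp add: norm_power T)
    also have "\<dots> \<le> (\<Sum>e\<in>A. (2 / ?v\<^sup>2)\<^sup>2)"
    proof (rule efron_stein[OF fin p])
      fix E e assume "e \<in> A"
      then obtain x y where e: "e = {x, y}" "x < n" "y < n" "x \<noteq> y" unfolding A_def by (rule all_edgesE)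
      show "norm (T (insert e E) - T (E - {e})) \<le> 2 / ?v\<^sup>2"
        unfolding T_def resolvent_trace_def e(1)
        by (intro resolvent_trace_edge_perturbation_le[OF sym_wigner sym_wigner z e(2-4)] wigner_flip e)
    qed
    also have "\<dots> = real (card A) * (4 / ?v^4)" by (simp add: power_divide power_mult[symmetric])
    also have "\<dots> \<le> real (n\<^sup>2) * (4 / ?v^4)"
      using card_all_edges_le[of n] z unfolding A_def by (intro mult_right_mono) auto
    finally show ?thesis by (simp add: mult_ac)
  qed
  have eq: "of_nat n + z * m + of_real q * m\<^sup>2 =
     (of_nat n + z * m + q *\<^sub>R (avg A p (\<lambda>E. (T E)\<^sup>2) + avg A p Q)) - q *\<^sub>R avg A p Q - q *\<^sub>R (avg A p (\<lambda>E. (T E)\<^sup>2) - m\<^sup>2)"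
    by (simp add: scaleR_conv_of_real algebra_simps)
  have "norm (of_nat n + z * m + of_real q * m\<^sup>2) \<le> (q * (4 * (real n)\<^sup>2 / ?v^3) + q * (2 * real n / ?v\<^sup>2)) + q * (real n / ?v\<^sup>2) + q * (4 * (real n)\<^sup>2 / ?v^4)"
    unfolding eq using main q mult_left_mono[OF Q q] mult_left_mono[OF var q]
    by (intro order_trans[OF norm_triangle_ineq4] add_mono) simp_all
  also have "\<dots> = q * (4 * (real n)\<^sup>2 / ?v^3 + 3 * real n / ?v\<^sup>2 + 4 * (real n)\<^sup>2 / ?v^4)"
    by (simp add: algebra_simps)
  finally show ?thesis .
qed

section \<open>Coulson's integral and the semicircle constant\<close>

lemma resolvent_trace_spectral:
  assumes "sym_on n M"
  obtains l where "trace_norm n M = (\<Sum>k<n. \<bar>l k\<bar>)" "(\<Sum>k<n. (l k)\<^sup>2) = (\<Sum>i<n. \<Sum>j<n. (M i j)\<^sup>2)"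
    "\<And>z. resolvent_trace n M z = (\<Sum>k<n. 1 / (of_real (l k) - z))"
proof -
  obtain U l where U: "diagonalizes n U l M"
    and R: "\<And>z i j. resolvent n M z i j = (\<Sum>k<n. of_real (U k i * U k j) / (of_real (l k) - z))"
    using resolvent_spectral[OF assms] by blast
  have o: "orthonormal n U" using U by (simp add: diagonalizes_def)
  have "resolvent_trace n M z = (\<Sum>k<n. 1 / (of_real (l k) - z))" for z
  proof -
    have "resolvent_trace n M z = (\<Sum>k<n. \<Sum>a<n. of_real (U k a * U k a) / (of_real (l k) - z))"
      unfolding resolvent_trace_def R by (rule sum.swap)
    also have "\<dots> = (\<Sum>k<n. of_real (\<Sum>a<n. U k a * U k a) / (of_real (l k) - z))"
      by (simp only: sum_divide_distrib of_real_sum)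
    also have "\<dots> = (\<Sum>k<n. 1 / (of_real (l k) - z))"
      using orthonormalD(1)[OF o] by simp
    finally show ?thesis .
  qed
  thus ?thesis using that trace_norm_eq_sum_eigenvalues[OF U] diagonalizes_sum_squares[OF U] by blast
qed

text \<open>For \<open>t > 0\<close> this is the trace of \<open>M\<^sup>2 (M\<^sup>2 + t\<^sup>2)\<^sup>-\<^sup>1\<close>, the integrand in Coulson's formula for
  the energy.\<close>

definition coulson :: "nat \<Rightarrow> (nat \<Rightarrow> nat \<Rightarrow> real) \<Rightarrow> real \<Rightarrow> real" where
  "coulson n M t = real n - t * Im (resolvent_trace n M (Complex 0 t))"

lemma Im_inverse_resolvent: "Im (1 / (of_real x - Complex 0 t)) = t / (x\<^sup>2 + t\<^sup>2)"
  by (simp add: Im_divide)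

lemma coulson_spectral:
  assumes "\<And>z. resolvent_trace n M z = (\<Sum>k<n. 1 / (of_real (l k) - z))" and t: "t > 0"
  shows "coulson n M t = (\<Sum>k<n. (l k)\<^sup>2 / ((l k)\<^sup>2 + t\<^sup>2))"
proof -
  have "coulson n M t = (\<Sum>k<n. 1 - t * (t / ((l k)\<^sup>2 + t\<^sup>2)))"
    unfolding coulson_def assms(1) Im_sum Im_inverse_resolvent by (simp add: sum_subtractf sum_distrib_left)
  also have "\<dots> = (\<Sum>k<n. (l k)\<^sup>2 / ((l k)\<^sup>2 + t\<^sup>2))"
  proof (intro sum.cong refl)
    fix k
    have "(l k)\<^sup>2 + t\<^sup>2 > 0" using t by (simp add: add_nonneg_pos)
    thus "1 - t * (t / ((l k)\<^sup>2 + t\<^sup>2)) = (l k)\<^sup>2 / ((l k)\<^sup>2 + t\<^sup>2)"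
      using t by (simp add: diff_eq_eq add_divide_distrib[symmetric] power2_eq_square)
  qed
  finally show ?thesis .
qed

lemma Im_resolvent_trace_nonneg:
  assumes "sym_on n M" "t > 0"
  shows "0 \<le> Im (resolvent_trace n M (Complex 0 t))"
proof -
  obtain l where l: "\<And>z. resolvent_trace n M z = (\<Sum>k<n. 1 / (of_real (l k) - z))"
    using resolvent_trace_spectral[OF assms(1)] by metis
  show ?thesis unfolding l Im_sum Im_inverse_resolvent using assms(2) by (intro sum_nonneg) auto
qed

text \<open>The second and third bound dominate the integrand near zero and near infinity.\<close>

lemma coulson_bounds:
  assumes "sym_on n M" "t > 0"
  shows "0 \<le> coulson n M t" "coulson n M t \<le> real n"
    "coulson n M t \<le> (\<Sum>i<n. \<Sum>j<n. (M i j)\<^sup>2) / t\<^sup>2"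
proof -
  obtain l where l: "\<And>z. resolvent_trace n M z = (\<Sum>k<n. 1 / (of_real (l k) - z))"
     "(\<Sum>k<n. (l k)\<^sup>2) = (\<Sum>i<n. \<Sum>j<n. (M i j)\<^sup>2)"
    using resolvent_trace_spectral[OF assms(1)] by metis
  note c = coulson_spectral[OF l(1) assms(2)]
  show "0 \<le> coulson n M t" unfolding c by (intro sum_nonneg) auto
  show "coulson n M t \<le> real n"
    unfolding coulson_def using Im_resolvent_trace_nonneg[OF assms] assms(2) by simp
  show "coulson n M t \<le> (\<Sum>i<n. \<Sum>j<n. (M i j)\<^sup>2) / t\<^sup>2"
    unfolding c l(2)[symmetric] sum_divide_distrib using assms(2)
    by (intro sum_mono divide_left_mono mult_pos_pos add_nonneg_pos) auto
qed

lemma has_bochner_integral_FTC_pos_halfline: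
  fixes f F :: "real \<Rightarrow> real"
  assumes "\<And>t. t > 0 \<Longrightarrow> (F has_real_derivative f t) (at t)" "\<And>t. t > 0 \<Longrightarrow> isCont f t"
    and "\<And>t. t > 0 \<Longrightarrow> 0 \<le> f t"
    and "(F \<longlongrightarrow> a) (at_right 0)" "(F \<longlongrightarrow> b) at_top"
  shows "has_bochner_integral lborel (\<lambda>t. indicator {0<..} t * f t) (b - a)"
proof -
  have *: "set_integrable lborel (einterval 0 \<infinity>) f" "(LBINT x=0..\<infinity>. f x) = b - a"
    using assms
    by (intro interval_integral_FTC_nonneg[of 0 \<infinity> F f a b];
        auto simp: zero_ereal_def ereal_tendsto_simps)+
  have "einterval 0 \<infinity> = {0::real<..}" by (simp add: zero_ereal_def einterval_eq)
  thus ?thesis using *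
    by (simp add: has_bochner_integral_iff set_integrable_def interval_lebesgue_integral_def set_lebesgue_integral_def)
qed

text \<open>Coulson's formula for one eigenvalue, with antiderivative \<open>\<bar>x\<bar> / c * arctan (c * t / \<bar>x\<bar>)\<close>. The
  scale \<open>c\<close> serves to normalise the spectrum.\<close>

lemma abs_as_integral:
  fixes x c :: real
  assumes c: "c > 0"
  shows "has_bochner_integral lborel (\<lambda>t. indicator {0<..} t * (x\<^sup>2 / (x\<^sup>2 + (c * t)\<^sup>2))) (\<bar>x\<bar> * (pi / (2 * c)))"
proof (cases "x = 0")
  case False
  define y where "y = \<bar>x\<bar>"
  have y: "y > 0" "x\<^sup>2 = y\<^sup>2" using False by (auto simp: y_def)
  have "has_bochner_integral lborel (\<lambda>t. indicator {0<..} t * (y\<^sup>2 / (y\<^sup>2 + (c * t)\<^sup>2))) (y * (pi / (2 * c)) - 0)"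
  proof (rule has_bochner_integral_FTC_pos_halfline[where F = "\<lambda>t. y / c * arctan (c * t / y)"])
    fix t :: real assume t: "t > 0"
    have pos: "y\<^sup>2 + (c * t)\<^sup>2 > 0" using y by (intro add_pos_nonneg) auto
    have "((\<lambda>t. y / c * arctan (c * t / y)) has_real_derivative y / c * (inverse (1 + (c * t / y)\<^sup>2) * (c / y))) (at t)"
      using c y by (auto intro!: derivative_eq_intros)
    also have "y / c * (inverse (1 + (c * t / y)\<^sup>2) * (c / y)) = y\<^sup>2 / (y\<^sup>2 + (c * t)\<^sup>2)"
      using c y pos by (simp add: field_simps power2_eq_square)
    finally show "((\<lambda>t. y / c * arctan (c * t / y)) has_real_derivative y\<^sup>2 / (y\<^sup>2 + (c * t)\<^sup>2)) (at t)" .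
    show "isCont (\<lambda>t. y\<^sup>2 / (y\<^sup>2 + (c * t)\<^sup>2)) t" using pos by (intro continuous_intros) auto
    show "0 \<le> y\<^sup>2 / (y\<^sup>2 + (c * t)\<^sup>2)" by simp
  next
    have "isCont (\<lambda>t. y / c * arctan (c * t / y)) 0" using y c by (intro continuous_intros) auto
    thus "((\<lambda>t. y / c * arctan (c * t / y)) \<longlongrightarrow> 0) (at_right 0)"
      by (simp add: continuous_within tendsto_mono[OF at_le[of "{0<..}" UNIV]])
    have "filterlim (\<lambda>t. c / y * t) at_top at_top"
      using c y by (intro filterlim_tendsto_pos_mult_at_top[OF tendsto_const]) (auto simp: filterlim_ident)
    hence "((\<lambda>t. arctan (c / y * t)) \<longlongrightarrow> pi / 2) at_top"
      by (rule filterlim_compose[OF tendsto_arctan_at_top])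
    from tendsto_mult[OF tendsto_const[of "y / c"] this]
    show "((\<lambda>t. y / c * arctan (c * t / y)) \<longlongrightarrow> y * (pi / (2 * c))) at_top"
      by (simp add: mult_ac)
  qed
  thus ?thesis unfolding y(2) by (simp add: y_def)
qed (simp add: has_bochner_integral_zero)

lemma trace_norm_as_integral:
  assumes "sym_on n M" and c: "c > 0"
  shows "has_bochner_integral lborel (\<lambda>t. indicator {0<..} t * coulson n M (c * t)) (trace_norm n M * (pi / (2 * c)))"
proof -
  obtain l where l: "trace_norm n M = (\<Sum>k<n. \<bar>l k\<bar>)" "\<And>z. resolvent_trace n M z = (\<Sum>k<n. 1 / (of_real (l k) - z))"
    using resolvent_trace_spectral[OF assms(1)] by metis
  have "has_bochner_integral lborel (\<lambda>t. \<Sum>k<n. indicator {0<..} t * ((l k)\<^sup>2 / ((l k)\<^sup>2 + (c * t)\<^sup>2)))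
     (\<Sum>k<n. \<bar>l k\<bar> * (pi / (2 * c)))"
    by (intro has_bochner_integral_sum abs_as_integral c)
  also have "(\<lambda>t. \<Sum>k<n. indicator {0<..} t * ((l k)\<^sup>2 / ((l k)\<^sup>2 + (c * t)\<^sup>2))) =
     (\<lambda>t. indicator {0<..} t * coulson n M (c * t))"
    using c by (auto simp: fun_eq_iff coulson_spectral[OF l(2)] indicator_def)
  finally show ?thesis by (simp only: l(1) sum_distrib_right)
qed

lemma has_bochner_integral_avg:
  assumes fin: "finite A"
    and "\<And>S. has_bochner_integral lborel (\<lambda>t. indicator {0<..} t * f S t) (x S)"
  shows "has_bochner_integral lborel (\<lambda>t::real. indicator {0<..} t * avg A p (\<lambda>S. f S t)) (avg A p x :: real)"
proof -
  have avg_sum: "avg A p F = (\<Sum>S\<in>Pow A. pmf (random_subset A p) S * F S)" for F :: "'a set \<Rightarrow> real"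
    unfolding avg_def using set_random_subset[of A p] fin
    by (subst integral_measure_pmf[of "Pow A"]) auto
  have "has_bochner_integral lborel (\<lambda>t. \<Sum>S\<in>Pow A. pmf (random_subset A p) S * (indicator {0<..} t * f S t)) (avg A p x)"
    unfolding avg_sum by (intro has_bochner_integral_sum has_bochner_integral_mult_right assms)
  thus ?thesis unfolding avg_sum by (simp add: sum_distrib_left mult_ac)
qed

text \<open>The imaginary part at \<open>\<i> * t\<close> of the Stieltjes transform of the semicircle law on
  \<open>[- 2, 2]\<close>.\<close>

definition semicircle_im :: "real \<Rightarrow> real" where
  "semicircle_im t = (sqrt (t\<^sup>2 + 4) - t) / 2"

lemma semicircle_im_nonneg: "0 \<le> semicircle_im t"
  unfolding semicircle_im_def by (simp add: real_le_rsqrt)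

lemma semicircle_im_eq: "(semicircle_im t)\<^sup>2 + t * semicircle_im t = 1"
proof -
  have "(sqrt (t\<^sup>2 + 4))\<^sup>2 = t\<^sup>2 + 4" by simp
  thus ?thesis unfolding semicircle_im_def by (simp add: power2_eq_square field_simps)
qed

text \<open>Up to the factor \<open>2 / pi\<close> this is the first absolute moment \<open>8 / (3 * pi)\<close> of the semicircle
  law.\<close>

lemma semicircle_integral:
  "has_bochner_integral lborel (\<lambda>t. indicator {0<..} t * (1 - t * semicircle_im t)) (4 / 3)"
proof -
  let ?F = "\<lambda>t::real. t + t ^ 3 / 6 - (t\<^sup>2 + 4) * sqrt (t\<^sup>2 + 4) / 6"
  have "has_bochner_integral lborel (\<lambda>t. indicator {0<..} t * (1 - t * semicircle_im t)) (0 - (- 4 / 3))"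
  proof (rule has_bochner_integral_FTC_pos_halfline[where F = ?F])
    fix t :: real assume t: "t > 0"
    define r where "r = sqrt (t\<^sup>2 + 4)"
    have pos: "t\<^sup>2 + 4 > 0" by (intro add_nonneg_pos) auto
    hence r: "r > 0" "r\<^sup>2 = t\<^sup>2 + 4" by (auto simp: r_def)
    define S where "S = (\<lambda>t::real. sqrt (t\<^sup>2 + 4))"
    \<comment> \<open>Naming the root keeps the derivative a rational expression in \<open>t\<close> and \<open>r\<close>.\<close>
    have S: "(S has_real_derivative t / r) (at t)"
      using pos unfolding r_def S_def by (auto intro!: derivative_eq_intros simp: field_simps)
    have "((\<lambda>t. t + t ^ 3 / 6 - (t\<^sup>2 + 4) * S t / 6) has_real_derivative
        1 + 3 * t\<^sup>2 / 6 - ((2 * t) * S t + (t\<^sup>2 + 4) * (t / r)) / 6) (at t)"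
      by (auto intro!: derivative_eq_intros S simp: algebra_simps)
    hence "(?F has_real_derivative 1 + 3 * t\<^sup>2 / 6 - ((2 * t) * r + r\<^sup>2 * (t / r)) / 6) (at t)"
      unfolding r(2) by (simp add: S_def r_def)
    also have "1 + 3 * t\<^sup>2 / 6 - ((2 * t) * r + r\<^sup>2 * (t / r)) / 6 = 1 - t * semicircle_im t"
      unfolding semicircle_im_def r_def[symmetric] using r(1)
      by (simp add: field_simps power2_eq_square)
    finally show "(?F has_real_derivative 1 - t * semicircle_im t) (at t)" .
    show "isCont (\<lambda>t. 1 - t * semicircle_im t) t"
      unfolding semicircle_im_def by (intro continuous_intros) auto
    show "0 \<le> 1 - t * semicircle_im t"
      using semicircle_im_eq[of t] by (smt (verit) zero_le_power2)
  next
    have "isCont ?F 0" by (intro continuous_intros) auto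
    hence "(?F \<longlongrightarrow> ?F 0) (at_right 0)"
      unfolding continuous_within by (rule tendsto_mono[OF at_le, rotated]) auto
    moreover have "sqrt 4 = (2::real)" using real_sqrt_abs[of 2] by simp
    ultimately show "(?F \<longlongrightarrow> - 4 / 3) (at_right 0)" by simp
    show "(?F \<longlongrightarrow> 0) at_top" by real_asymp
  qed
  thus ?thesis by simp
qed

context
  fixes p :: real
  assumes p: "0 < p" "p < 1"
begin

text \<open>Let \<open>s\<close> be the mean of the normalised resolvent trace at \<open>\<i> * t\<close>. By the self-consistent equation it satisfies
  \<open>s\<^sup>2 + \<i> * t * s + 1 = o(1)\<close>, while \<open>\<i> * g\<close> with \<open>g = semicircle_im t\<close> solves the equation exactly. The difference of
  the two equations factors as \<open>(s - \<i> * g) * (s + \<i> * g + \<i> * t)\<close>, and the second factor has imaginary part at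
  least \<open>t\<close>, which bounds the first one.\<close>

lemma coulson_avg_limit:
  assumes t: "t > 0"
  shows "(\<lambda>n. avg (all_edges n) p (\<lambda>E. coulson n (wigner p E) (sqrt (real n * (p * (1 - p))) * t)) / real n)
     \<longlonglongrightarrow> 1 - t * semicircle_im t"
proof -
  define q where "q = p * (1 - p)"
  have q: "q > 0" using p by (simp add: q_def)
  \<comment> \<open>The spectrum of the Wigner matrix lives on the scale \<open>c n\<close>.\<close>
  define c where "c n = sqrt (real n * q)" for n
  define m where "m n = avg (all_edges n) p (\<lambda>E. resolvent_trace n (wigner p E) (Complex 0 (c n * t)))" for n
  define s where "s n = of_real (c n / real n) * m n" for n
  define err where "err n = q * (4 * real n / (c n * t)^3 + 3 / (c n * t)\<^sup>2 + 4 * real n / (c n * t)^4)" for n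
  let ?g = "semicircle_im t"
  have ev: "\<forall>\<^sub>F n in sequentially. n > 0" by (rule eventually_gt_at_top)
  have bound: "norm (s n - \<i> * of_real ?g) \<le> err n / t" if n: "n > 0" for n
  proof -
    have c: "c n > 0" "(c n)\<^sup>2 = real n * q" using n q by (auto simp: c_def)
    have ct: "c n * t > 0" using c t by simp
    have eq: "of_nat n + Complex 0 (c n * t) * m n + of_real q * (m n)\<^sup>2 =
        of_nat n * ((s n)\<^sup>2 + \<i> * of_real t * s n + 1)"
    proof -
      have "of_nat n * (s n)\<^sup>2 = of_real (real n * (c n / real n)\<^sup>2) * (m n)\<^sup>2"
        by (simp add: s_def power_mult_distrib power_divide)
      also have "real n * (c n / real n)\<^sup>2 = q" unfolding power_divide c(2) using n by (simp add: power2_eq_square)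
      finally have 1: "of_nat n * (s n)\<^sup>2 = of_real q * (m n)\<^sup>2" .
      have "Complex 0 (c n * t) = \<i> * of_real (c n * t)" by (simp add: complex_eq_iff)
      hence 2: "of_nat n * (\<i> * of_real t * s n) = Complex 0 (c n * t) * m n"
        using n by (simp add: s_def)
      show ?thesis using 1 2 by (simp add: algebra_simps)
    qed
    have "real n * norm ((s n)\<^sup>2 + \<i> * of_real t * s n + 1) =
       norm (of_nat n + Complex 0 (c n * t) * m n + of_real q * (m n)\<^sup>2)"
      unfolding eq norm_mult by simp
    also have "\<dots> \<le> q * (4 * (real n)\<^sup>2 / (c n * t)^3 + 3 * real n / (c n * t)\<^sup>2 + 4 * (real n)\<^sup>2 / (c n * t)^4)"
      using self_consistent_equation[of p "Complex 0 (c n * t)" n] p ct by (simp add: m_def q_def)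
    also have "\<dots> = real n * err n" by (simp add: err_def algebra_simps power2_eq_square)
    finally have 1: "norm ((s n)\<^sup>2 + \<i> * of_real t * s n + 1) \<le> err n" using n by simp
    have g: "of_real ?g * of_real ?g + of_real t * of_real ?g = (1::complex)"
      using semicircle_im_eq[of t] by (metis of_real_1 of_real_add of_real_mult power2_eq_square)
    have "(s n)\<^sup>2 + \<i> * of_real t * s n + 1 = (s n)\<^sup>2 + \<i> * of_real t * s n + (of_real ?g * of_real ?g + of_real t * of_real ?g)"
      unfolding g ..
    also have "\<dots> = (s n - \<i> * of_real ?g) * (s n + \<i> * of_real ?g + \<i> * of_real t)"
      by (simp add: power2_eq_square algebra_simps)
    finally have 2: "norm ((s n)\<^sup>2 + \<i> * of_real t * s n + 1) = norm (s n - \<i> * of_real ?g) * norm (s n + \<i> * of_real ?g + \<i> * of_real t)"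
      by (simp add: norm_mult)
    have "0 \<le> Im (m n)"
      unfolding m_def avg_bounded_linear[OF finite_all_edges bounded_linear_Im, symmetric]
      by (intro avg_nonneg finite_all_edges Im_resolvent_trace_nonneg sym_wigner ct)
    hence "t \<le> Im (s n + \<i> * of_real ?g + \<i> * of_real t)"
      using c semicircle_im_nonneg[of t] by (simp add: s_def)
    also have "\<dots> \<le> norm (s n + \<i> * of_real ?g + \<i> * of_real t)"
      using abs_Im_le_cmod abs_le_D1 by blast
    finally have "norm (s n - \<i> * of_real ?g) * t \<le> norm (s n - \<i> * of_real ?g) * norm (s n + \<i> * of_real ?g + \<i> * of_real t)"
      by (intro mult_left_mono) auto
    with 1 2 have "norm (s n - \<i> * of_real ?g) * t \<le> err n" by linarith
    thus ?thesis using t by (simp add: field_simps)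
  qed
  have "(\<lambda>n. err n / t) \<longlonglongrightarrow> 0"
    unfolding err_def c_def using q t by real_asymp
  hence "(\<lambda>n. s n - \<i> * of_real ?g) \<longlonglongrightarrow> 0"
    by (rule Lim_null_comparison[rotated]) (use ev in eventually_elim, use bound in auto)
  hence "s \<longlonglongrightarrow> \<i> * of_real ?g" by (simp add: LIM_zero_iff)
  hence "(\<lambda>n. 1 - t * Im (s n)) \<longlonglongrightarrow> 1 - t * Im (\<i> * of_real ?g)"
    by (intro tendsto_intros)
  also have "Im (\<i> * of_real ?g) = ?g" by simp
  finally show ?thesis
  proof (rule Lim_transform_eventually)
    show "\<forall>\<^sub>F n in sequentially. 1 - t * Im (s n) =
        avg (all_edges n) p (\<lambda>E. coulson n (wigner p E) (sqrt (real n * (p * (1 - p))) * t)) / real n"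
      using ev
    proof eventually_elim
      case (elim n)
      have "avg (all_edges n) p (\<lambda>E. coulson n (wigner p E) (c n * t)) = real n - c n * t * Im (m n)"
        unfolding coulson_def avg_diff[OF finite_all_edges] avg_cmult[OF finite_all_edges]
          avg_const[OF finite_all_edges] avg_bounded_linear[OF finite_all_edges bounded_linear_Im] m_def ..
      thus ?case using elim by (simp add: c_def q_def s_def field_simps)
    qed
  qed
qed

text \<open>Coulson's formula writes the mean trace norm as an integral over \<open>t\<close> of mean resolvent traces, whose
  pointwise limit is known. Since the integrand lies below a constant multiple of \<open>1 / (1 + t\<^sup>2)\<close>
  uniformly in \<open>n\<close>, limit and integral may be exchanged.\<close>

theorem trace_norm_wigner_avg_limit:
  "(\<lambda>n. avg (all_edges n) p (\<lambda>E. trace_norm n (wigner p E)) / real n powr (3 / 2))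
     \<longlonglongrightarrow> 8 / (3 * pi) * sqrt (p * (1 - p))"
proof -
  define q where "q = p * (1 - p)"
  have q: "q > 0" using p by (simp add: q_def)
  define c where "c n = sqrt (real n * q)" for n
  define G where "G n t = avg (all_edges n) p (\<lambda>E. coulson n (wigner p E) (c n * t)) / real n" for n t
  define I where "I n = avg (all_edges n) p (\<lambda>E. trace_norm n (wigner p E)) * (pi / (2 * c n)) / real n" for n
  have G: "has_bochner_integral lborel (\<lambda>t. indicator {0<..} t * G n t) (I n)" for n
  proof (cases "n = 0")
    case False
    have "c n > 0" using False q by (simp add: c_def)
    hence "has_bochner_integral lborel (\<lambda>t. indicator {0<..} t * avg (all_edges n) p (\<lambda>E. coulson n (wigner p E) (c n * t)))
      (avg (all_edges n) p (\<lambda>E. trace_norm n (wigner p E) * (pi / (2 * c n))))"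
      by (intro has_bochner_integral_avg finite_all_edges trace_norm_as_integral sym_wigner)
    also have "avg (all_edges n) p (\<lambda>E. trace_norm n (wigner p E) * (pi / (2 * c n))) = avg (all_edges n) p (\<lambda>E. trace_norm n (wigner p E)) * (pi / (2 * c n))"
      using avg_cmult[OF finite_all_edges, of n p "pi / (2 * c n)" "\<lambda>E. trace_norm n (wigner p E)"] by (simp add: mult_ac)
    finally have "has_bochner_integral lborel (\<lambda>t. indicator {0<..} t * avg (all_edges n) p (\<lambda>E. coulson n (wigner p E) (c n * t)))
      (avg (all_edges n) p (\<lambda>E. trace_norm n (wigner p E)) * (pi / (2 * c n)))" .
    from has_bochner_integral_divide_zero[OF this, of "real n"]
    show ?thesis by (simp add: G_def I_def)
  qed (simp add: G_def I_def has_bochner_integral_zero)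
  have dom: "norm (indicator {0<..} t * G n t) \<le> (1 + 1 / q) * (indicator {0<..} t * (1 / (1 + t\<^sup>2)))" for n t
  proof (cases "t > 0 \<and> n > 0")
    case True
    hence t: "t > 0" and n: "n > 0" by auto
    have c: "c n > 0" "(c n)\<^sup>2 = real n * q" using n q by (auto simp: c_def)
    have ct: "c n * t > 0" using c t by simp
    have pos: "1 + t\<^sup>2 > 0" by (simp add: add_pos_nonneg)
    have 0: "0 \<le> G n t" unfolding G_def
      by (intro divide_nonneg_nonneg avg_nonneg finite_all_edges coulson_bounds sym_wigner ct) simp
    have "avg (all_edges n) p (\<lambda>E. coulson n (wigner p E) (c n * t)) \<le> avg (all_edges n) p (\<lambda>_. real n)"
      by (intro avg_mono finite_all_edges coulson_bounds sym_wigner ct)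
    hence 1: "G n t \<le> 1" unfolding G_def avg_const[OF finite_all_edges] using n by (simp add: field_simps)
    have "avg (all_edges n) p (\<lambda>E. coulson n (wigner p E) (c n * t)) \<le> avg (all_edges n) p (\<lambda>_. (real n)\<^sup>2 / (c n * t)\<^sup>2)"
    proof (intro avg_mono finite_all_edges)
      fix E
      have "(wigner p E i j)\<^sup>2 \<le> 1" for i j
        using p by (auto simp: wigner_def abs_square_le_1)
      hence "(\<Sum>i<n. \<Sum>j<n. (wigner p E i j)\<^sup>2) \<le> (\<Sum>i<n. \<Sum>j<n. 1)"
        by (intro sum_mono) auto
      hence "(\<Sum>i<n. \<Sum>j<n. (wigner p E i j)\<^sup>2) / (c n * t)\<^sup>2 \<le> (real n)\<^sup>2 / (c n * t)\<^sup>2"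
        by (intro divide_right_mono) (auto simp: power2_eq_square)
      thus "coulson n (wigner p E) (c n * t) \<le> (real n)\<^sup>2 / (c n * t)\<^sup>2"
        using coulson_bounds(3)[OF sym_wigner ct, of n p E] by linarith
    qed
    hence "G n t \<le> (real n)\<^sup>2 / (c n * t)\<^sup>2 / real n"
      unfolding G_def avg_const[OF finite_all_edges] by (intro divide_right_mono) auto
    also have "\<dots> = 1 / q / t\<^sup>2" unfolding power_mult_distrib c(2) using n by (simp add: power2_eq_square)
    finally have "G n t * t\<^sup>2 \<le> 1 / q / t\<^sup>2 * t\<^sup>2" by (rule mult_right_mono) simp
    hence "G n t * t\<^sup>2 \<le> 1 / q" using t by simp
    hence "G n t * (1 + t\<^sup>2) \<le> 1 + 1 / q" using 1 by (simp add: distrib_left)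
    hence "G n t \<le> (1 + 1 / q) * (1 / (1 + t\<^sup>2))" using pos by (simp add: pos_le_divide_eq)
    thus ?thesis using t 0 by simp
  next
    case False
    thus ?thesis using q by (auto simp: G_def indicator_def)
  qed
  have "has_bochner_integral lborel (\<lambda>t. indicator {0<..} t * (1\<^sup>2 / (1\<^sup>2 + (1 * t)\<^sup>2))) (\<bar>1\<bar> * (pi / (2 * 1)))"
    by (rule abs_as_integral) simp
  hence w: "integrable lborel (\<lambda>t::real. (1 + 1 / q) * (indicator {0<..} t * (1 / (1 + t\<^sup>2))))"
    by (intro integrable_mult_right) (simp add: has_bochner_integral_iff)
  have lim: "(\<lambda>n. indicator {0<..} t * G n t) \<longlonglongrightarrow> indicator {0<..} t * (1 - t * semicircle_im t)" for t
  proof (cases "t > 0")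
    case True
    thus ?thesis using coulson_avg_limit[OF True] by (simp add: G_def c_def q_def)
  qed simp
  have "(\<lambda>n. integral\<^sup>L lborel (\<lambda>t. indicator {0<..} t * G n t)) \<longlonglongrightarrow> integral\<^sup>L lborel (\<lambda>t. indicator {0<..} t * (1 - t * semicircle_im t))"
  proof (rule integral_dominated_convergence[OF _ _ w])
    show "(\<lambda>t. indicator {0<..} t * (1 - t * semicircle_im t)) \<in> borel_measurable lborel"
      using semicircle_integral by (intro borel_measurable_integrable) (simp add: has_bochner_integral_iff)
    show "(\<lambda>t. indicator {0<..} t * G n t) \<in> borel_measurable lborel" for n
      using G[of n] by (intro borel_measurable_integrable) (simp add: has_bochner_integral_iff)
  qed (use lim dom in auto)
  hence "I \<longlonglongrightarrow> 4 / 3"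
    using has_bochner_integral_integral_eq[OF G] has_bochner_integral_integral_eq[OF semicircle_integral] by simp
  hence "(\<lambda>n. I n * (2 * sqrt q / pi)) \<longlonglongrightarrow> 4 / 3 * (2 * sqrt q / pi)" by (intro tendsto_intros)
  hence "(\<lambda>n. I n * (2 * sqrt q / pi)) \<longlonglongrightarrow> 8 / (3 * pi) * sqrt q" by simp
  thus ?thesis unfolding q_def[symmetric]
  proof (rule Lim_transform_eventually)
    show "\<forall>\<^sub>F n in sequentially. I n * (2 * sqrt q / pi) = avg (all_edges n) p (\<lambda>E. trace_norm n (wigner p E)) / real n powr (3 / 2)"
      using eventually_gt_at_top[of 0]
    proof eventually_elim
      case (elim n)
      have "real n powr (3 / 2) = real n powr (1 + 1 / 2)" by simp
      also have "\<dots> = real n * sqrt (real n)" using elim by (subst powr_add) (simp add: powr_half_sqrt)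
      finally have *: "real n powr (3 / 2) = real n * sqrt (real n)" .
      show ?case unfolding * I_def c_def using elim q by (simp add: real_sqrt_mult field_simps)
    qed
  qed
qed

end

section \<open>Concentration and comparison with the Wigner matrix\<close>

lemma avg_shifted_square_le:
  fixes F :: "'a set \<Rightarrow> real"
  assumes "finite A" "0 \<le> p" "p \<le> 1"
    and "\<And>S e. S \<subseteq> A \<Longrightarrow> e \<in> A \<Longrightarrow> \<bar>F (insert e S) - F (S - {e})\<bar> \<le> c e"
  shows "avg A p (\<lambda>S. (F S - b)\<^sup>2) \<le> (\<Sum>e\<in>A. (c e)\<^sup>2) + (avg A p F - b)\<^sup>2"
proof -
  have "avg A p (\<lambda>S. (F S - avg A p F)\<^sup>2) \<le> (\<Sum>e\<in>A. (c e)\<^sup>2)"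
    using efron_stein[OF assms(1-3), of F c] assms(4) by simp
  thus ?thesis
    using variance_eq[OF assms(1), of p F "avg A p F"] variance_eq[OF assms(1), of p F b]
    by (simp add: power2_eq_square algebra_simps)
qed

lemma abs_avg_le_sqrt:
  fixes F :: "'a set \<Rightarrow> real"
  assumes "finite A" "avg A p (\<lambda>S. (F S)\<^sup>2) \<le> b"
  shows "avg A p F \<le> sqrt b"
  using avg_square_le[OF assms(1), of p F] assms(2) by (intro real_le_rsqrt) linarith

text \<open>Flipping an edge changes the trace norm by at most 2, so its variance is
  \<open>O(n\<^sup>2)\<close>, whereas its mean is of order \<open>n powr (3 / 2)\<close>.\<close>

lemma trace_norm_wigner_deviation:
  assumes p: "0 \<le> p" "p \<le> 1"
  shows "avg (all_edges n) p (\<lambda>E. \<bar>trace_norm n (wigner p E) - avg (all_edges n) p (\<lambda>E. trace_norm n (wigner p E))\<bar>) \<le> 2 * real n"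
proof -
  define A where "A = all_edges n"
  define X where "X = (\<lambda>E. trace_norm n (wigner p E))"
  have fin: "finite A" by (simp add: A_def finite_all_edges)
  have "avg A p (\<lambda>E. (X E - avg A p X)\<^sup>2) \<le> (\<Sum>e\<in>A. 2\<^sup>2) + (avg A p X - avg A p X)\<^sup>2"
  proof (rule avg_shifted_square_le[OF fin p])
    fix E e assume "e \<in> A"
    then obtain x y where e: "e = {x, y}" "x < n" "y < n" "x \<noteq> y" unfolding A_def by (rule all_edgesE)
    have "\<bar>X (insert e E) - X (E - {e})\<bar> \<le> trace_norm n (\<lambda>i j. wigner p (insert e E) i j - wigner p (E - {e}) i j)"
      unfolding X_def by (intro trace_norm_diff_le sym_wigner)
    also have "\<dots> \<le> (\<Sum>i<n. \<Sum>j<n. \<bar>wigner p (insert e E) i j - wigner p (E - {e}) i j\<bar>)"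
      using sym_wigner by (intro trace_norm_le_sum_abs) (simp add: sym_on_def)
    also have "\<dots> = (\<Sum>i<n. \<Sum>j<n. of_bool (i = x) * of_bool (j = y) + of_bool (i = y) * of_bool (j = x))"
      unfolding e(1) wigner_flip[OF e(4)] using e(4) by (intro sum.cong refl) (auto simp: doubleton_eq_iff)
    also have "\<dots> = (\<Sum>i<n. of_bool (i = x) * (\<Sum>j<n. of_bool (j = y) * 1)) + (\<Sum>i<n. of_bool (i = y) * (\<Sum>j<n. of_bool (j = x) * 1))"
      by (simp only: sum.distrib sum_distrib_left mult_1_right)
    also have "\<dots> = 2" using e by (simp only: sum_of_bool_collapse)
    finally show "\<bar>X (insert e E) - X (E - {e})\<bar> \<le> 2" .
  qed
  also have "\<dots> \<le> 4 * (real n)\<^sup>2"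
    using card_all_edges_le[of n] by (simp add: A_def flip: of_nat_power)
  finally have "avg A p (\<lambda>E. \<bar>X E - avg A p X\<bar>\<^sup>2) \<le> (2 * real n)\<^sup>2" by (simp add: power_mult_distrib)
  from abs_avg_le_sqrt[OF fin this] show ?thesis
    by (simp only: A_def X_def real_sqrt_abs)
qed

definition star_edges :: "nat \<Rightarrow> nat \<Rightarrow> edge_set" where
  "star_edges n i = {e \<in> all_edges n. i \<in> e}"

lemma card_star_edges: "i < n \<Longrightarrow> card (star_edges n i) = n - 1"
proof -
  assume i: "i < n"
  have "star_edges n i = (\<lambda>j. {i, j}) ` ({..<n} - {i})"
    using i by (auto simp: star_edges_def all_edges_def card_2_iff doubleton_eq_iff image_iff)
  moreover have "inj_on (\<lambda>j. {i, j}) ({..<n} - {i})" by (auto simp: inj_on_def doubleton_eq_iff)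
  ultimately show ?thesis using i by (simp add: card_image)
qed

lemma finite_star_edges: "finite (star_edges n i)"
  by (simp add: star_edges_def finite_all_edges)

lemma sum_star_edges: "(\<Sum>e\<in>all_edges n. of_bool (i \<in> e)) = (real (card (star_edges n i)))"
  by (simp add: star_edges_def finite_all_edges Int_def)

lemma vdegree_eq: "E \<subseteq> all_edges n \<Longrightarrow> real (vdegree E i) = (\<Sum>e\<in>star_edges n i. of_bool (e \<in> E))"
  unfolding vdegree_def
  by (simp add: finite_star_edges) (intro arg_cong[where f = card], auto simp: star_edges_def)

lemma vdegree_le: "E \<subseteq> all_edges n \<Longrightarrow> i < n \<Longrightarrow> real (vdegree E i) \<le> real n"
proof -
  assume "E \<subseteq> all_edges n" "i < n"
  hence "real (vdegree E i) \<le> (\<Sum>e\<in>star_edges n i. 1)" unfolding vdegree_eq[OF \<open>E \<subseteq> all_edges n\<close>]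
    by (intro sum_mono) auto
  thus ?thesis using card_star_edges[OF \<open>i < n\<close>] by simp
qed

text \<open>The number of common neighbours; where it vanishes, the distance may exceed 2.\<close>

definition codegree :: "nat \<Rightarrow> edge_set \<Rightarrow> nat \<Rightarrow> nat \<Rightarrow> real" where
  "codegree n E i j = (\<Sum>w\<in>{..<n} - {i, j}. of_bool ({i, w} \<in> E) * of_bool ({j, w} \<in> E))"

text \<open>Up to scaling, a bound for the squared Frobenius norm of the off-diagonal error made by replacing all
  degrees by \<open>n * p\<close> and all distances by 1 or 2. Pairs without a common neighbour
  are charged the trivial bound.\<close>

definition defect :: "real \<Rightarrow> nat \<Rightarrow> edge_set \<Rightarrow> real" where
  "defect p n E = (\<Sum>i<n. \<Sum>j<n. (real (vdegree E i) - real n * p)\<^sup>2 + (real (vdegree E j) - real n * p)\<^sup>2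
      + (real n)\<^sup>2 * of_bool (i \<noteq> j \<and> codegree n E i j = 0))"

context
  fixes p :: real and n :: nat
  assumes p: "0 < p" "p < 1"
begin

lemma avg_edge: "e \<in> all_edges n \<Longrightarrow> avg (all_edges n) p (\<lambda>E. of_bool (e \<in> E)) = p"
  using avg_indicator[of "all_edges n" e p "\<lambda>_. 1"] p by (simp add: finite_all_edges avg_const)

lemma degree_deviation:
  assumes i: "i < n"
  shows "avg (all_edges n) p (\<lambda>E. (real (vdegree E i) - real n * p)\<^sup>2) \<le> real n"
proof -
  define A where "A = all_edges n"
  have fin: "finite A" by (simp add: A_def finite_all_edges)
  define F where "F = (\<lambda>E. \<Sum>e\<in>star_edges n i. of_bool (e \<in> E) :: real)"
  have mean: "avg A p F = real (n - 1) * p"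
    unfolding F_def avg_sum[OF fin] using card_star_edges[OF i] avg_edge
    by (simp add: A_def star_edges_def)
  have "avg A p (\<lambda>E. (real (vdegree E i) - real n * p)\<^sup>2) = avg A p (\<lambda>E. (F E - real n * p)\<^sup>2)"
    unfolding A_def F_def by (intro avg_cong finite_all_edges) (simp add: vdegree_eq)
  also have "\<dots> \<le> (\<Sum>e\<in>A. (of_bool (i \<in> e))\<^sup>2) + (avg A p F - real n * p)\<^sup>2"
  proof (rule avg_shifted_square_le[OF fin])
    fix E e assume e: "e \<in> A"
    have "F (insert e E) - F (E - {e}) = (\<Sum>f\<in>star_edges n i. if f = e then 1 else 0)"
      unfolding F_def sum_subtractf[symmetric] by (intro sum.cong) auto
    also have "\<dots> = of_bool (i \<in> e)" using e by (simp add: finite_star_edges) (simp add: star_edges_def A_def)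
    finally show "\<bar>F (insert e E) - F (E - {e})\<bar> \<le> of_bool (i \<in> e)" by simp
  qed (use p in auto)
  also have "(\<Sum>e\<in>A. (of_bool (i \<in> e))\<^sup>2) = real (n - 1)"
    using card_star_edges[OF i] sum_star_edges[of i n] by (simp add: A_def power2_eq_square of_bool_conj[symmetric])
  also have "avg A p F - real n * p = - p" using i by (simp add: mean of_nat_diff algebra_simps)
  also have "real (n - 1) + (- p)\<^sup>2 \<le> real n"
    using i p by (simp add: of_nat_diff abs_square_le_1)
  finally show ?thesis by (simp add: A_def)
qed

text \<open>Chebyshev's inequality: the codegree has mean of order \<open>n\<close> and, by
  Efron--Stein, variance \<open>O(n)\<close>, because only the edges at \<open>i\<close> or \<open>j\<close> influence it. This leaves an expected \<open>O(n)\<close> pairs at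
  distance larger than 2, too many to be excluded but few enough to be harmless in trace norm.\<close>

lemma codegree_zero_avg:
  assumes ij: "i < n" "j < n" "i \<noteq> j" and n: "n \<ge> 4"
  shows "avg (all_edges n) p (\<lambda>E. of_bool (codegree n E i j = 0)) \<le> 16 / (real n * p ^ 4)"
proof -
  define A where "A = all_edges n"
  have fin: "finite A" by (simp add: A_def finite_all_edges)
  define V where "V = {..<n} - {i, j}"
  define \<mu> where "\<mu> = (real n - 2) * p\<^sup>2"
  have mean: "avg A p (\<lambda>E. codegree n E i j) = \<mu>"
  proof -
    have "avg A p (\<lambda>E. of_bool ({i, w} \<in> E) * of_bool ({j, w} \<in> E)) = p\<^sup>2" if "w \<in> V" for w
    proof -
      have e: "{i, w} \<in> A" "{j, w} \<in> A" "{j, w} \<noteq> {i, w}"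
        using that ij by (auto simp: A_def V_def doubleton_eq_iff intro!: edge_in_all_edges)
      have "avg A p (\<lambda>E. of_bool ({i, w} \<in> E) * of_bool ({j, w} \<in> E)) = p * avg A p (\<lambda>E. of_bool ({j, w} \<in> insert {i, w} E))"
        using p by (intro avg_indicator fin e) auto
      also have "\<dots> = p * p" using e avg_edge[of "{j, w}"] by (simp add: A_def)
      finally show ?thesis by (simp add: power2_eq_square)
    qed
    hence "avg A p (\<lambda>E. codegree n E i j) = (\<Sum>w\<in>V. p\<^sup>2)"
      unfolding codegree_def V_def[symmetric] avg_sum[OF fin] by simp
    moreover have "card V = n - 2" using ij by (simp add: V_def card_Diff_subset)
    ultimately show ?thesis using n by (simp add: \<mu>_def of_nat_diff)
  qed
  have "avg A p (\<lambda>E. (codegree n E i j - \<mu>)\<^sup>2) \<le> (\<Sum>e\<in>A. (of_bool (i \<in> e) + of_bool (j \<in> e))\<^sup>2) + (avg A p (\<lambda>E. codegree n E i j) - \<mu>)\<^sup>2"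
  proof (rule avg_shifted_square_le[OF fin])
    fix E e assume e: "e \<in> A"
    have count: "(\<Sum>w\<in>V. of_bool ({k, w} = e)) \<le> (of_bool (k \<in> e) :: real)" if "k \<in> {i, j}" for k
    proof (cases "\<exists>w\<in>V. {k, w} = e")
      case True
      then obtain w where w: "w \<in> V" "{k, w} = e" by auto
      hence "(\<Sum>w'\<in>V. of_bool ({k, w'} = e)) = (\<Sum>w'\<in>V. if w' = w then 1 else 0 :: real)"
        by (intro sum.cong) (auto simp: doubleton_eq_iff)
      also have "\<dots> = 1" using w by (simp add: V_def)
      finally show ?thesis using w by auto
    next
      case False
      hence "(\<Sum>w'\<in>V. of_bool ({k, w'} = e)) = (0 :: real)" by (intro sum.neutral) auto
      thus ?thesis by simp
    qed
    have "\<bar>codegree n (insert e E) i j - codegree n (E - {e}) i j\<bar> \<le> (\<Sum>w\<in>V. of_bool ({i, w} = e) + of_bool ({j, w} = e))"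
      unfolding codegree_def V_def[symmetric] sum_subtractf[symmetric]
      by (intro order_trans[OF sum_abs] sum_mono) (auto simp: of_bool_def)
    also have "\<dots> \<le> of_bool (i \<in> e) + of_bool (j \<in> e)"
      unfolding sum.distrib by (intro add_mono count) auto
    finally show "\<bar>codegree n (insert e E) i j - codegree n (E - {e}) i j\<bar> \<le> of_bool (i \<in> e) + of_bool (j \<in> e)" .
  qed (use p in auto)
  also have "\<dots> \<le> (\<Sum>e\<in>A. 2 * of_bool (i \<in> e) + 2 * of_bool (j \<in> e))"
    unfolding mean by (simp, intro sum_mono) (auto simp: of_bool_def)
  also have "\<dots> = 2 * real (n - 1) + 2 * real (n - 1)"
    unfolding sum.distrib sum_distrib_left[symmetric] A_def sum_star_edges
    using ij by (simp add: card_star_edges)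
  also have "\<dots> \<le> 4 * real n" by simp
  finally have var: "avg A p (\<lambda>E. (codegree n E i j - \<mu>)\<^sup>2) \<le> 4 * real n" .
  have \<mu>: "\<mu> \<ge> real n / 2 * p\<^sup>2" "\<mu> > 0" "real n / 2 * p\<^sup>2 > 0"
    unfolding \<mu>_def using n p by (auto intro!: mult_right_mono)
  have "avg A p (\<lambda>E. of_bool (codegree n E i j = 0)) \<le> avg A p (\<lambda>E. (1 / \<mu>\<^sup>2) * (codegree n E i j - \<mu>)\<^sup>2)"
    using \<mu> by (intro avg_mono fin) (auto simp: of_bool_def)
  also have "\<dots> = (1 / \<mu>\<^sup>2) * avg A p (\<lambda>E. (codegree n E i j - \<mu>)\<^sup>2)" by (rule avg_cmult[OF fin])
  also have "\<dots> \<le> (1 / (real n / 2 * p\<^sup>2)\<^sup>2) * (4 * real n)"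
  proof (intro mult_mono var)
    have "0 < \<mu>\<^sup>2 * (real n / 2 * p\<^sup>2)\<^sup>2"
      using \<mu>(2,3) n p by (intro mult_pos_pos zero_less_power) auto
    thus "1 / \<mu>\<^sup>2 \<le> 1 / (real n / 2 * p\<^sup>2)\<^sup>2"
      using \<mu> by (intro divide_left_mono power_mono) auto
  qed (auto intro: avg_nonneg fin)
  also have "\<dots> = 16 / (real n * p ^ 4)"
    using n p by (simp add: power_mult_distrib power_divide field_simps eval_nat_numeral)
  finally show ?thesis by (simp add: A_def)
qed

lemma defect_avg_le:
  assumes n: "n \<ge> 4"
  shows "avg (all_edges n) p (defect p n) \<le> (2 + 16 / p ^ 4) * real n ^ 3"
proof -
  define A where "A = all_edges n"
  have fin: "finite A" by (simp add: A_def finite_all_edges)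
  have "avg A p (\<lambda>E. (real (vdegree E i) - real n * p)\<^sup>2 + (real (vdegree E j) - real n * p)\<^sup>2
      + (real n)\<^sup>2 * of_bool (i \<noteq> j \<and> codegree n E i j = 0)) \<le> real n + real n + (real n)\<^sup>2 * (16 / (real n * p ^ 4))"
    if "i < n" "j < n" for i j
  proof -
    have "avg A p (\<lambda>E. of_bool (i \<noteq> j \<and> codegree n E i j = 0)) \<le> 16 / (real n * p ^ 4)"
    proof (cases "i = j")
      case False
      thus ?thesis using codegree_zero_avg[OF that False n] by (simp add: A_def)
    qed (use p in \<open>simp add: avg_const[OF fin]\<close>)
    thus ?thesis unfolding avg_add[OF fin] avg_cmult[OF fin]
      using degree_deviation[OF that(1)] degree_deviation[OF that(2)]
      by (intro add_mono mult_left_mono) (auto simp: A_def)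
  qed
  hence "avg A p (defect p n) \<le> (\<Sum>i<n. \<Sum>j<n. real n + real n + (real n)\<^sup>2 * (16 / (real n * p ^ 4)))"
    unfolding defect_def avg_sum[OF fin] by (intro sum_mono) auto
  also have "\<dots> = (2 + 16 / p ^ 4) * real n ^ 3"
    using n p by (simp add: field_simps eval_nat_numeral)
  finally show ?thesis by (simp add: A_def)
qed

text \<open>The matrix with entries \<open>\<alpha> * (1 + of_bool ({i, j} \<in> E))\<close> off the diagonal is \<open>\<alpha>\<close> times the Wigner matrix
  plus a multiple of the all-ones matrix, apart from its diagonal. The all-ones part has trace norm
  only \<open>n\<close> times its coefficient; the deviation of \<open>H\<close> from that matrix is bounded by \<open>sqrt n\<close> times
  its Frobenius norm.\<close>

lemma trace_norm_perturbation:
  assumes n: "n \<ge> 1" and E: "E \<subseteq> all_edges n" and K: "0 \<le> K" and \<alpha>: "0 \<le> \<alpha>" "\<alpha> \<le> K * real n"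
    and H: "sym_on n H" "\<And>i. i < n \<Longrightarrow> H i i = 0"
    and near: "\<And>i j. i < n \<Longrightarrow> j < n \<Longrightarrow> i \<noteq> j \<Longrightarrow> \<bar>H i j - \<alpha> * (1 + of_bool ({i, j} \<in> E))\<bar> \<le>
       K * (\<bar>real (vdegree E i) - real n * p\<bar> + \<bar>real (vdegree E j) - real n * p\<bar> + real n * of_bool (codegree n E i j = 0))"
  shows "\<bar>trace_norm n H - \<alpha> * trace_norm n (wigner p E)\<bar> \<le> 2 * K * (real n)\<^sup>2 + K * sqrt (real n * (3 * defect p n E + 4 * real n ^ 3))"
proof -
  \<comment> \<open>Off the diagonal, \<open>1 + of_bool ({i, j} \<in> E) = wigner p E i j + (1 + p)\<close>.\<close>
  define \<beta> where "\<beta> = \<alpha> * (1 + p)"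
  have \<beta>: "0 \<le> \<beta>" "\<beta> \<le> 2 * K * real n"
  proof -
    have "\<beta> \<le> \<alpha> * 2" unfolding \<beta>_def using p \<alpha> by (intro mult_left_mono) auto
    thus "\<beta> \<le> 2 * K * real n" using \<alpha> by simp
  qed (use p \<alpha> in \<open>simp add: \<beta>_def\<close>)
  define D where "D = (\<lambda>i j. H i j - \<alpha> * wigner p E i j - \<beta> * 1)"
  define J where "J = (\<lambda>(i::nat) (j::nat). 1::real)"
  have sJ: "sym_on n J" "sym_on n (\<lambda>i j. \<beta> * J i j)" by (auto simp: J_def sym_on_def)
  have sD: "sym_on n D" using H(1) sym_wigner[of n p E] by (simp add: D_def sym_on_def)
  have sW: "sym_on n (\<lambda>i j. \<alpha> * wigner p E i j)" using sym_wigner[of n p E] by (simp add: sym_on_def)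
  have "\<bar>trace_norm n H - \<alpha> * trace_norm n (wigner p E)\<bar> = \<bar>trace_norm n H - trace_norm n (\<lambda>i j. \<alpha> * wigner p E i j)\<bar>"
    using \<alpha> by (simp add: trace_norm_scale[OF sym_wigner])
  also have "\<dots> \<le> trace_norm n (\<lambda>i j. H i j - \<alpha> * wigner p E i j)"
    by (rule trace_norm_diff_le[OF H(1) sW])
  also have "\<dots> = trace_norm n (\<lambda>i j. \<beta> * J i j + D i j)"
    by (simp add: D_def J_def)
  also have "\<dots> \<le> trace_norm n (\<lambda>i j. \<beta> * J i j) + trace_norm n D"
    by (rule trace_norm_triangle[OF sJ(2) sD])
  also have "trace_norm n (\<lambda>i j. \<beta> * J i j) \<le> 2 * K * (real n)\<^sup>2"
  proof -
    have "trace_norm n (\<lambda>i j. \<beta> * J i j) \<le> \<beta> * real n"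
      unfolding trace_norm_scale[OF sJ(1)] using \<beta> trace_norm_all_ones[of n] unfolding J_def by (simp add: mult_left_mono)
    also have "\<dots> \<le> 2 * K * real n * real n" using \<beta> by (intro mult_right_mono) auto
    finally show ?thesis by (simp add: power2_eq_square)
  qed
  also have "trace_norm n D \<le> K * sqrt (real n * (3 * defect p n E + 4 * real n ^ 3))"
  proof -
    have entry: "(D i j)\<^sup>2 \<le> K\<^sup>2 * (3 * ((real (vdegree E i) - real n * p)\<^sup>2 + (real (vdegree E j) - real n * p)\<^sup>2
      + (real n)\<^sup>2 * of_bool (i \<noteq> j \<and> codegree n E i j = 0)) + of_bool (i = j) * (4 * (real n)\<^sup>2))"
      if ij: "i < n" "j < n" for i j
    proof (cases "i = j")
      case True
      have "(D i j)\<^sup>2 = \<beta>\<^sup>2" using True H(2) ij by (simp add: D_def wigner_def)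
      also have "\<dots> \<le> (2 * K * real n)\<^sup>2" using \<beta> by (intro power_mono)
      also have "\<dots> = K\<^sup>2 * (0 + 4 * (real n)\<^sup>2)" by (simp add: power_mult_distrib)
      also have "\<dots> \<le> K\<^sup>2 * (3 * ((real (vdegree E i) - real n * p)\<^sup>2 + (real (vdegree E j) - real n * p)\<^sup>2
        + (real n)\<^sup>2 * of_bool (i \<noteq> j \<and> codegree n E i j = 0)) + 4 * (real n)\<^sup>2)"
        by (intro mult_left_mono add_right_mono) auto
      finally show ?thesis using True by simp
    next
      case False
      define a b c where "a = \<bar>real (vdegree E i) - real n * p\<bar>" and "b = \<bar>real (vdegree E j) - real n * p\<bar>"
        and "c = real n * of_bool (codegree n E i j = 0)"
      have "D i j = H i j - \<alpha> * (1 + of_bool ({i, j} \<in> E))"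
        using False by (simp add: D_def wigner_def \<beta>_def algebra_simps)
      hence "\<bar>D i j\<bar> \<le> K * (a + b + c)" using near[OF ij False] by (simp add: a_def b_def c_def)
      hence "(D i j)\<^sup>2 \<le> (K * (a + b + c))\<^sup>2" by (rule abs_le_square_iff[THEN iffD1, OF order_trans]) auto
      also have "(a + b + c)\<^sup>2 \<le> 3 * (a\<^sup>2 + b\<^sup>2 + c\<^sup>2)"
      proof -
        have "0 \<le> (a - b)\<^sup>2 + (b - c)\<^sup>2 + (a - c)\<^sup>2" by simp
        thus ?thesis by (simp add: power2_eq_square algebra_simps)
      qed
      hence "(K * (a + b + c))\<^sup>2 \<le> K\<^sup>2 * (3 * (a\<^sup>2 + b\<^sup>2 + c\<^sup>2))"
        unfolding power_mult_distrib by (intro mult_left_mono) auto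
      finally show ?thesis using False
        by (simp add: a_def b_def c_def power_mult_distrib of_bool_def split: if_splits)
    qed
    have "(trace_norm n D)\<^sup>2 \<le> real n * (\<Sum>i<n. \<Sum>j<n. (D i j)\<^sup>2)" by (rule trace_norm_sq_le[OF sD])
    also have "\<dots> \<le> real n * (\<Sum>i<n. \<Sum>j<n. K\<^sup>2 * (3 * ((real (vdegree E i) - real n * p)\<^sup>2 + (real (vdegree E j) - real n * p)\<^sup>2
      + (real n)\<^sup>2 * of_bool (i \<noteq> j \<and> codegree n E i j = 0)) + of_bool (i = j) * (4 * (real n)\<^sup>2)))"
      using entry by (intro mult_left_mono sum_mono) auto
    also have "\<dots> = real n * (K\<^sup>2 * (3 * defect p n E + (\<Sum>i<n. \<Sum>j<n. of_bool (i = j) * (4 * (real n)\<^sup>2))))"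
      unfolding defect_def by (simp only: sum_distrib_left[symmetric] sum.distrib)
    also have "(\<Sum>i<n. \<Sum>j<n. of_bool (i = j) * (4 * (real n)\<^sup>2)) = (\<Sum>i<n. 4 * (real n)\<^sup>2)"
      by (intro sum.cong refl) (simp only: sum_of_bool_collapse lessThan_iff)
    also have "real n * (K\<^sup>2 * (3 * defect p n E + (\<Sum>i<n. 4 * (real n)\<^sup>2))) = K\<^sup>2 * (real n * (3 * defect p n E + 4 * real n ^ 3))"
      by (simp add: eval_nat_numeral)
    finally have "trace_norm n D \<le> sqrt (K\<^sup>2 * (real n * (3 * defect p n E + 4 * real n ^ 3)))"
      by (rule real_le_rsqrt)
    thus ?thesis using K by (simp add: real_sqrt_mult)
  qed
  finally show ?thesis by simp
qed

lemma trace_norm_perturbation_avg: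
  assumes n: "n \<ge> 4" and K: "0 \<le> K" and \<alpha>: "0 \<le> \<alpha>" "\<alpha> \<le> K * real n"
    and H: "\<And>E. E \<subseteq> all_edges n \<Longrightarrow> sym_on n (H E)" "\<And>E i. i < n \<Longrightarrow> H E i i = 0"
    and near: "\<And>E i j. E \<subseteq> all_edges n \<Longrightarrow> i < n \<Longrightarrow> j < n \<Longrightarrow> i \<noteq> j \<Longrightarrow> \<bar>H E i j - \<alpha> * (1 + of_bool ({i, j} \<in> E))\<bar> \<le>
       K * (\<bar>real (vdegree E i) - real n * p\<bar> + \<bar>real (vdegree E j) - real n * p\<bar> + real n * of_bool (codegree n E i j = 0))"
  shows "avg (all_edges n) p (\<lambda>E. \<bar>trace_norm n (H E) - \<alpha> * trace_norm n (wigner p E)\<bar>) \<le> (2 + sqrt (10 + 48 / p ^ 4)) * K * (real n)\<^sup>2"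
proof -
  define A where "A = all_edges n"
  have fin: "finite A" by (simp add: A_def finite_all_edges)
  define X where "X = (\<lambda>E. sqrt (real n * (3 * defect p n E + 4 * real n ^ 3)))"
  have nonneg: "0 \<le> defect p n E" for E unfolding defect_def by (intro sum_nonneg) auto
  have "avg A p (\<lambda>E. (X E)\<^sup>2) = avg A p (\<lambda>E. real n * (3 * defect p n E + 4 * real n ^ 3))"
    unfolding X_def using nonneg by (intro avg_cong[OF fin]) simp
  also have "\<dots> = real n * (3 * avg A p (defect p n) + 4 * real n ^ 3)"
    unfolding avg_cmult[OF fin] avg_add[OF fin] avg_const[OF fin] ..
  also have "\<dots> \<le> real n * (3 * ((2 + 16 / p ^ 4) * real n ^ 3) + 4 * real n ^ 3)"
    using defect_avg_le[OF n] unfolding A_def by (intro mult_left_mono add_right_mono) auto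
  also have "\<dots> = (10 + 48 / p ^ 4) * ((real n)\<^sup>2)\<^sup>2"
    by (simp add: algebra_simps eval_nat_numeral)
  finally have "avg A p X \<le> sqrt ((10 + 48 / p ^ 4) * ((real n)\<^sup>2)\<^sup>2)" by (rule abs_avg_le_sqrt[OF fin])
  also have "\<dots> = sqrt (10 + 48 / p ^ 4) * (real n)\<^sup>2" by (simp only: real_sqrt_mult real_sqrt_abs) simp
  finally have X: "avg A p X \<le> sqrt (10 + 48 / p ^ 4) * (real n)\<^sup>2" .
  have "avg A p (\<lambda>E. \<bar>trace_norm n (H E) - \<alpha> * trace_norm n (wigner p E)\<bar>) \<le> avg A p (\<lambda>E. 2 * K * (real n)\<^sup>2 + K * X E)"
    unfolding X_def A_def using n
    by (intro avg_mono finite_all_edges trace_norm_perturbation K \<alpha> H near) auto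
  also have "\<dots> = 2 * K * (real n)\<^sup>2 + K * avg A p X"
    unfolding avg_cmult[OF fin] avg_add[OF fin] avg_const[OF fin] ..
  also have "\<dots> \<le> 2 * K * (real n)\<^sup>2 + K * (sqrt (10 + 48 / p ^ 4) * (real n)\<^sup>2)"
    using X K by (intro add_left_mono mult_left_mono)
  finally show ?thesis by (simp add: A_def algebra_simps)
qed

end

section \<open>From convergence in mean to almost sure asymptotics\<close>

text \<open>Markov's inequality at the level \<open>\<epsilon>\<close>, for a mean of at most \<open>\<epsilon>\<^sup>2\<close>.\<close>

lemma prob_ge_of_avg_abs:
  fixes Y :: "'a set \<Rightarrow> real"
  assumes fin: "finite A" and \<epsilon>: "\<epsilon> > 0" and Y: "avg A p (\<lambda>E. \<bar>Y E\<bar>) \<le> \<epsilon>\<^sup>2"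
    and Q: "\<And>E. \<bar>Y E\<bar> \<le> \<epsilon> \<Longrightarrow> Q E"
  shows "1 - \<epsilon> \<le> measure_pmf.prob (random_subset A p) {E. Q E}"
proof -
  have "1 - \<epsilon> \<le> 1 - (1 / \<epsilon>) * avg A p (\<lambda>E. \<bar>Y E\<bar>)"
    using \<epsilon> Y by (simp add: field_simps power2_eq_square)
  also have "\<dots> = avg A p (\<lambda>E. 1 - (1 / \<epsilon>) * \<bar>Y E\<bar>)"
    unfolding avg_diff[OF fin] avg_cmult[OF fin] avg_const[OF fin] ..
  also have "\<dots> \<le> avg A p (indicator {E. Q E})"
  proof (rule avg_mono[OF fin])
    fix E
    show "1 - (1 / \<epsilon>) * \<bar>Y E\<bar> \<le> indicator {E. Q E} E"
    proof (cases "\<bar>Y E\<bar> \<le> \<epsilon>")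
      case True
      thus ?thesis using Q \<epsilon> by (simp add: indicator_def)
    next
      case False
      hence "1 \<le> (1 / \<epsilon>) * \<bar>Y E\<bar>" using \<epsilon> by (simp add: field_simps)
      thus ?thesis by (simp add: indicator_def)
    qed
  qed
  also have "\<dots> = measure_pmf.prob (random_subset A p) {E. Q E}"
    by (simp add: avg_def)
  finally show ?thesis .
qed

text \<open>The deterministic error sequence is the square root of the mean error. Adding \<open>1 / (n + 1)\<close> keeps it
  positive even if the mean error vanishes.\<close>

lemma gnp_as_asymp_of_mean:
  assumes lim: "(\<lambda>n. avg (all_edges n) p (\<lambda>E. \<bar>X n E / real n powr a - c\<bar>)) \<longlonglongrightarrow> 0"
  shows "gnp_as_asymp p X c a"
proof -
  define r where "r n = avg (all_edges n) p (\<lambda>E. \<bar>X n E / real n powr a - c\<bar>)" for n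
  define \<epsilon> where "\<epsilon> n = sqrt (r n + inverse (real (Suc n)))" for n
  have r0: "0 \<le> r n" for n unfolding r_def by (intro avg_nonneg finite_all_edges) simp
  have "(\<lambda>n. sqrt (r n + inverse (real (Suc n)))) \<longlonglongrightarrow> sqrt (0 + 0)"
    by (intro tendsto_intros lim[folded r_def] LIMSEQ_inverse_real_of_nat)
  hence \<epsilon>: "\<epsilon> \<longlonglongrightarrow> 0" by (simp add: \<epsilon>_def[abs_def])
  let ?P = "\<lambda>n E. \<exists>\<delta>. \<bar>\<delta>\<bar> \<le> \<epsilon> n \<and> X n E = (c + \<delta>) * real n powr a"
  have low: "1 - \<epsilon> n \<le> measure_pmf.prob (gnp n p) {E. ?P n E}" if n: "n > 0" for n
    unfolding gnp_eq_random_subset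
  proof (rule prob_ge_of_avg_abs[OF finite_all_edges])
    have pos: "0 < r n + inverse (real (Suc n))" using r0[of n] by (intro add_nonneg_pos) auto
    thus "\<epsilon> n > 0" by (simp add: \<epsilon>_def)
    show "avg (all_edges n) p (\<lambda>E. \<bar>X n E / real n powr a - c\<bar>) \<le> (\<epsilon> n)\<^sup>2"
      using pos by (simp add: \<epsilon>_def r_def[symmetric])
    fix E assume "\<bar>X n E / real n powr a - c\<bar> \<le> \<epsilon> n"
    thus "?P n E" using n by (intro exI[of _ "X n E / real n powr a - c"]) simp
  qed
  have "(\<lambda>n. measure_pmf.prob (gnp n p) {E. ?P n E}) \<longlonglongrightarrow> 1"
  proof (rule tendsto_sandwich)
    show "\<forall>\<^sub>F n in sequentially. 1 - \<epsilon> n \<le> measure_pmf.prob (gnp n p) {E. ?P n E}"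
      using eventually_gt_at_top[of 0] by eventually_elim (rule low)
    show "(\<lambda>n. 1 - \<epsilon> n) \<longlonglongrightarrow> 1" using tendsto_diff[OF tendsto_const[of 1] \<epsilon>] by simp
  qed auto
  thus ?thesis unfolding gnp_as_asymp_def gnp_as_def using \<epsilon> by blast
qed

text \<open>Covers both weightings: \<open>b = 0\<close>, \<open>\<kappa> = p\<close> for sums and \<open>b = 1\<close>, \<open>\<kappa> = p\<^sup>2 / 2\<close> for products of degrees. The
  error splits into the perturbation, the fluctuation of the trace norm of the Wigner matrix, and
  the distance of its mean from the limit.\<close>

lemma trace_norm_asymp:
  fixes p \<kappa> :: real and b :: nat
  assumes p: "0 < p" "p < 1" and \<kappa>: "0 \<le> \<kappa>" "\<kappa> \<le> 3"
    and H: "\<And>n E. E \<subseteq> all_edges n \<Longrightarrow> sym_on n (H n E)" "\<And>n E i. i < n \<Longrightarrow> H n E i i = 0"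
    and near: "\<And>n E i j. E \<subseteq> all_edges n \<Longrightarrow> i < n \<Longrightarrow> j < n \<Longrightarrow> i \<noteq> j \<Longrightarrow>
       \<bar>H n E i j - \<kappa> * real n ^ Suc b * (1 + of_bool ({i, j} \<in> E))\<bar> \<le>
       3 * real n ^ b * (\<bar>real (vdegree E i) - real n * p\<bar> + \<bar>real (vdegree E j) - real n * p\<bar> + real n * of_bool (codegree n E i j = 0))"
  shows "gnp_as_asymp p (\<lambda>n E. trace_norm n (H n E)) (\<kappa> * (8 / (3 * pi) * sqrt (p * (1 - p)))) (real b + 5 / 2)"
proof (rule gnp_as_asymp_of_mean)
  define m where "m n = avg (all_edges n) p (\<lambda>E. trace_norm n (wigner p E))" for n
  define L where "L = 8 / (3 * pi) * sqrt (p * (1 - p))"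
  define C where "C = 2 + sqrt (10 + 48 / p ^ 4)"
  have bound: "avg (all_edges n) p (\<lambda>E. \<bar>trace_norm n (H n E) / real n powr (real b + 5 / 2) - \<kappa> * L\<bar>) \<le>
      3 * C / sqrt (real n) + \<kappa> * (2 / sqrt (real n)) + \<kappa> * \<bar>m n / real n powr (3 / 2) - L\<bar>" if n: "n \<ge> 4" for n
  proof -
    have fin: "finite (all_edges n)" by (rule finite_all_edges)
    define N where "N = real n powr (real b + 5 / 2)"
    have "real n powr (3 / 2) = real n powr (1 + 1 / 2)" by simp
    also have "\<dots> = real n * sqrt (real n)" using n by (subst powr_add) (simp add: powr_half_sqrt)
    finally have h: "real n powr (3 / 2) = real n * sqrt (real n)" .
    have "N = real n powr (real (Suc b) + 3 / 2)" by (simp add: N_def add_ac)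
    also have "\<dots> = real n ^ Suc b * real n powr (3 / 2)" unfolding powr_add using n powr_realpow[of "real n" "Suc b"] by simp
    finally have N: "N = real n ^ Suc b * real n powr (3 / 2)" .
    have Npos: "N > 0" using n by (simp add: N_def)
    have "avg (all_edges n) p (\<lambda>E. \<bar>trace_norm n (H n E) / N - \<kappa> * L\<bar>) \<le>
      avg (all_edges n) p (\<lambda>E. (1 / N) * \<bar>trace_norm n (H n E) - (\<kappa> * real n ^ Suc b) * trace_norm n (wigner p E)\<bar>
        + \<kappa> / real n powr (3 / 2) * \<bar>trace_norm n (wigner p E) - m n\<bar> + \<kappa> * \<bar>m n / real n powr (3 / 2) - L\<bar>)"
    proof (rule avg_mono[OF fin])
      fix E
      let ?h = "trace_norm n (H n E)" and ?w = "trace_norm n (wigner p E)"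
      have "?h / N - \<kappa> * L = (1 / N) * (?h - (\<kappa> * real n ^ Suc b) * ?w)
        + \<kappa> / real n powr (3 / 2) * (?w - m n) + \<kappa> * (m n / real n powr (3 / 2) - L)"
      proof -
        define P Q where "P = real n ^ Suc b" and "Q = real n powr (3 / 2)"
        have "P \<noteq> 0" "Q \<noteq> 0" using n by (auto simp: P_def Q_def)
        thus ?thesis unfolding N P_def[symmetric] Q_def[symmetric] by (simp add: field_simps)
      qed
      also have "\<bar>\<dots>\<bar> \<le> \<bar>(1 / N) * (?h - (\<kappa> * real n ^ Suc b) * ?w)\<bar>
        + \<bar>\<kappa> / real n powr (3 / 2) * (?w - m n)\<bar> + \<bar>\<kappa> * (m n / real n powr (3 / 2) - L)\<bar>"
        by linarith
      also have "\<dots> = (1 / N) * \<bar>?h - (\<kappa> * real n ^ Suc b) * ?w\<bar>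
        + \<kappa> / real n powr (3 / 2) * \<bar>?w - m n\<bar> + \<kappa> * \<bar>m n / real n powr (3 / 2) - L\<bar>"
        unfolding abs_mult using \<kappa> Npos by simp
      finally show "\<bar>?h / N - \<kappa> * L\<bar> \<le> (1 / N) * \<bar>?h - (\<kappa> * real n ^ Suc b) * ?w\<bar>
        + \<kappa> / real n powr (3 / 2) * \<bar>?w - m n\<bar> + \<kappa> * \<bar>m n / real n powr (3 / 2) - L\<bar>" .
    qed
    also have "\<dots> = (1 / N) * avg (all_edges n) p (\<lambda>E. \<bar>trace_norm n (H n E) - (\<kappa> * real n ^ Suc b) * trace_norm n (wigner p E)\<bar>)
        + \<kappa> / real n powr (3 / 2) * avg (all_edges n) p (\<lambda>E. \<bar>trace_norm n (wigner p E) - m n\<bar>) + \<kappa> * \<bar>m n / real n powr (3 / 2) - L\<bar>"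
      unfolding avg_add[OF fin] avg_cmult[OF fin] avg_const[OF fin] ..
    also have "\<dots> \<le> (1 / N) * (C * (3 * real n ^ b) * (real n)\<^sup>2) + \<kappa> / real n powr (3 / 2) * (2 * real n) + \<kappa> * \<bar>m n / real n powr (3 / 2) - L\<bar>"
    proof (intro add_mono mult_left_mono order_refl)
      show "avg (all_edges n) p (\<lambda>E. \<bar>trace_norm n (H n E) - (\<kappa> * real n ^ Suc b) * trace_norm n (wigner p E)\<bar>) \<le> C * (3 * real n ^ b) * (real n)\<^sup>2"
        unfolding C_def
      proof (rule trace_norm_perturbation_avg[OF p n])
        have "\<kappa> * real n ^ Suc b \<le> 3 * real n ^ Suc b" using \<kappa> by (intro mult_right_mono) auto
        thus "\<kappa> * real n ^ Suc b \<le> 3 * real n ^ b * real n" by (simp add: mult_ac)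
      qed (use \<kappa> H near in auto)
      show "avg (all_edges n) p (\<lambda>E. \<bar>trace_norm n (wigner p E) - m n\<bar>) \<le> 2 * real n"
        unfolding m_def using p by (intro trace_norm_wigner_deviation) auto
    qed (use \<kappa> Npos in auto)
    also have "(1 / N) * (C * (3 * real n ^ b) * (real n)\<^sup>2) = 3 * C / sqrt (real n)"
      using n unfolding N h by (simp add: field_simps power2_eq_square)
    also have "\<kappa> / real n powr (3 / 2) * (2 * real n) = \<kappa> * (2 / sqrt (real n))"
      using n unfolding h by (simp add: field_simps)
    finally show ?thesis by (simp add: N_def)
  qed
  have "(\<lambda>n. 3 * C / sqrt (real n) + \<kappa> * (2 / sqrt (real n)) + \<kappa> * \<bar>m n / real n powr (3 / 2) - L\<bar>) \<longlonglongrightarrow> 0 + \<kappa> * 0 + \<kappa> * \<bar>L - L\<bar>"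
  proof (intro tendsto_intros)
    show "(\<lambda>n. 3 * C / sqrt (real n)) \<longlonglongrightarrow> 0" "(\<lambda>n. 2 / sqrt (real n)) \<longlonglongrightarrow> 0" by real_asymp+
    show "(\<lambda>n. m n / real n powr (3 / 2)) \<longlonglongrightarrow> L"
      unfolding m_def L_def by (rule trace_norm_wigner_avg_limit[OF p])
  qed
  hence "(\<lambda>n. 3 * C / sqrt (real n) + \<kappa> * (2 / sqrt (real n)) + \<kappa> * \<bar>m n / real n powr (3 / 2) - L\<bar>) \<longlonglongrightarrow> 0" by simp
  thus "(\<lambda>n. avg (all_edges n) p (\<lambda>E. \<bar>trace_norm n (H n E) / real n powr (real b + 5 / 2) - \<kappa> * (8 / (3 * pi) * sqrt (p * (1 - p)))\<bar>)) \<longlonglongrightarrow> 0"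
  proof (rule tendsto_sandwich[OF _ _ tendsto_const, rotated 2])
    show "\<forall>\<^sub>F n in sequentially. avg (all_edges n) p (\<lambda>E. \<bar>trace_norm n (H n E) / real n powr (real b + 5 / 2) - \<kappa> * (8 / (3 * pi) * sqrt (p * (1 - p)))\<bar>)
       \<le> 3 * C / sqrt (real n) + \<kappa> * (2 / sqrt (real n)) + \<kappa> * \<bar>m n / real n powr (3 / 2) - L\<bar>"
      unfolding L_def using eventually_ge_at_top[of 4] by eventually_elim (rule bound[unfolded L_def])
    show "\<forall>\<^sub>F n in sequentially. 0 \<le> avg (all_edges n) p (\<lambda>E. \<bar>trace_norm n (H n E) / real n powr (real b + 5 / 2) - \<kappa> * (8 / (3 * pi) * sqrt (p * (1 - p)))\<bar>)"
      by (intro always_eventually allI avg_nonneg finite_all_edges) simp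
  qed
qed

section \<open>The Harary matrices\<close>

lemma dist_graph_sym: "dist_graph E i j = dist_graph E j i"
proof -
  have s: "(adj E)\<inverse> = adj E" by (auto simp: adj_def insert_commute)
  have 1: "(j, i) \<in> adj E ^^ k" if "(i, j) \<in> adj E ^^ k" for i j k
    using that
  proof (induction k arbitrary: j)
    case (Suc k)
    then obtain w where "(i, w) \<in> adj E ^^ k" "(w, j) \<in> adj E" by auto
    hence "(w, i) \<in> adj E ^^ k" "(j, w) \<in> adj E" using Suc.IH s by auto
    thus ?case by (rule relpow_Suc_I2[rotated])
  qed auto
  hence "(i, j) \<in> adj E ^^ k \<longleftrightarrow> (j, i) \<in> adj E ^^ k" for k by blast
  moreover have "(i, j) \<in> (adj E)\<^sup>* \<longleftrightarrow> (j, i) \<in> (adj E)\<^sup>*"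
    using rtrancl_converse[of "adj E"] unfolding s by (metis converse_iff)
  ultimately show ?thesis by (simp add: dist_graph_def)
qed

text \<open>Pairs with a common neighbour are at distance 1 or 2, which makes the reciprocal distance an
  affine function of the adjacency matrix.\<close>

lemma inverse_dist_graph:
  assumes E: "E \<subseteq> all_edges n" and ij: "i \<noteq> j" and c: "codegree n E i j \<noteq> 0"
  shows "1 / real (dist_graph E i j) = (1 + of_bool ({i, j} \<in> E)) / 2"
proof (cases "{i, j} \<in> E")
  case True
  hence a: "(i, j) \<in> adj E" by (simp add: adj_def)
  have "(LEAST k. (i, j) \<in> adj E ^^ k) = 1"
  proof (rule Least_equality)
    fix k assume "(i, j) \<in> adj E ^^ k"
    thus "1 \<le> k" using ij by (cases k) auto
  qed (use a in simp)
  moreover have "(i, j) \<in> (adj E)\<^sup>*" using a by blast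
  ultimately show ?thesis using True by (simp add: dist_graph_def)
next
  case False
  have "\<exists>w. {i, w} \<in> E \<and> {j, w} \<in> E"
  proof (rule ccontr)
    assume "\<nexists>w. {i, w} \<in> E \<and> {j, w} \<in> E"
    hence "codegree n E i j = 0" unfolding codegree_def by (intro sum.neutral) auto
    thus False using c by contradiction
  qed
  then obtain w where "{i, w} \<in> E" "{j, w} \<in> E" by blast
  hence a: "(i, w) \<in> adj E" "(w, j) \<in> adj E" by (auto simp: adj_def insert_commute)
  have "(LEAST k. (i, j) \<in> adj E ^^ k) = 2"
  proof (rule Least_equality)
    show "(i, j) \<in> adj E ^^ 2" using a by (auto simp: numeral_2_eq_2)
    fix k assume k: "(i, j) \<in> adj E ^^ k"
    have "k \<noteq> 0" using k ij by (intro notI) simp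
    moreover have "k \<noteq> 1" using k False by (intro notI) (simp add: adj_def)
    ultimately show "2 \<le> k" by linarith
  qed
  moreover have "(i, j) \<in> (adj E)\<^sup>*" using a by (meson r_into_rtrancl rtrancl_trans)
  ultimately show ?thesis using False by (simp add: dist_graph_def)
qed

lemma inverse_nat_le_1: "1 / real k \<le> 1"
  by (cases k) auto

theorem corollary3p8:
  fixes p :: real
  assumes "0 < p" and "p < 1"
  shows "gnp_as_asymp p (\<lambda>n E. energy (harary_add n E))
           (8 / (3 * pi) * p * sqrt (p * (1 - p))) (5 / 2)
       \<and> gnp_as_asymp p (\<lambda>n E. energy (harary_mult n E))
           (4 / (3 * pi) * p ^ 2 * sqrt (p * (1 - p))) (7 / 2)"
proof
  note p = assms
  let ?d = "\<lambda>E i. real (vdegree E i)"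
  define HA where "HA = (\<lambda>(n::nat) E i j. if i = j then 0 else (?d E i + ?d E j) / real (dist_graph E i j))"
  define HM where "HM = (\<lambda>(n::nat) E i j. if i = j then 0 else (?d E i * ?d E j) / real (dist_graph E i j))"
  have sym: "sym_on n (HA n E)" "sym_on n (HM n E)" for n E
    by (auto simp: sym_on_def HA_def HM_def dist_graph_sym[of E] add.commute mult.commute)
  have "gnp_as_asymp p (\<lambda>n E. trace_norm n (HA n E)) (p * (8 / (3 * pi) * sqrt (p * (1 - p)))) (real 0 + 5 / 2)"
  proof (rule trace_norm_asymp[OF p])
    fix n E and i j :: nat
    assume E: "E \<subseteq> all_edges n" and ij: "i < n" "j < n" "i \<noteq> j"
    define e where "e = (1 + of_bool ({i, j} \<in> E) :: real)"
    have e: "0 \<le> e" "e \<le> 2" by (auto simp: e_def)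
    have d: "?d E i \<le> real n" "?d E j \<le> real n" using vdegree_le[OF E] ij by auto
    define q where "q = real n * p"
    have np: "0 \<le> q" "q \<le> real n" using p by (auto simp: q_def intro: mult_left_le)
    have "\<bar>HA n E i j - q * e\<bar> \<le>
       3 * (\<bar>?d E i - q\<bar> + \<bar>?d E j - q\<bar> + real n * of_bool (codegree n E i j = 0))"
    proof (cases "codegree n E i j = 0")
      case True
      have "HA n E i j = (?d E i + ?d E j) * (1 / real (dist_graph E i j))" using ij by (simp add: HA_def)
      also have "\<dots> \<le> (?d E i + ?d E j) * 1" by (intro mult_left_mono inverse_nat_le_1) auto
      finally have 1: "HA n E i j \<le> 2 * real n" using d by simp
      have 2: "0 \<le> HA n E i j" by (simp add: HA_def)
      have 3: "0 \<le> q * e" using np e by simp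
      have 4: "q * e \<le> real n * 2" using np e by (intro mult_mono) auto
      have "\<bar>HA n E i j - q * e\<bar> \<le> 3 * (0 + 0 + real n)" using 1 2 3 4 by (simp add: abs_le_iff)
      also have "\<dots> \<le> 3 * (\<bar>?d E i - q\<bar> + \<bar>?d E j - q\<bar> + real n)"
        by (intro mult_left_mono add_mono) auto
      finally show ?thesis using True by simp
    next
      case False
      have "HA n E i j = (?d E i + ?d E j) * (1 / real (dist_graph E i j))" using ij by (simp add: HA_def)
      also have "\<dots> = (?d E i + ?d E j) * (e / 2)" unfolding inverse_dist_graph[OF E ij(3) False] e_def ..
      finally have "HA n E i j - q * e = (e / 2) * ((?d E i - q) + (?d E j - q))"
        by (simp add: field_simps)
      hence "\<bar>HA n E i j - q * e\<bar> = \<bar>(e / 2) * ((?d E i - q) + (?d E j - q))\<bar>"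
        by (rule arg_cong)
      also have "\<dots> = (e / 2) * \<bar>(?d E i - q) + (?d E j - q)\<bar>"
        unfolding abs_mult using e by simp
      also have "\<dots> \<le> 3 * (\<bar>?d E i - q\<bar> + \<bar>?d E j - q\<bar>)"
        using e by (intro mult_mono abs_triangle_ineq) auto
      finally show ?thesis using False by simp
    qed
    thus "\<bar>HA n E i j - p * real n ^ Suc 0 * (1 + of_bool ({i, j} \<in> E))\<bar> \<le>
       3 * real n ^ 0 * (\<bar>?d E i - real n * p\<bar> + \<bar>?d E j - real n * p\<bar> + real n * of_bool (codegree n E i j = 0))"
      by (simp add: q_def e_def mult_ac)
  qed (use p sym in \<open>auto simp: HA_def\<close>)
  thus "gnp_as_asymp p (\<lambda>n E. energy (harary_add n E)) (8 / (3 * pi) * p * sqrt (p * (1 - p))) (5 / 2)"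
    unfolding trace_norm_def HA_def harary_add_def by (simp add: mult_ac)
  have "gnp_as_asymp p (\<lambda>n E. trace_norm n (HM n E)) (p\<^sup>2 / 2 * (8 / (3 * pi) * sqrt (p * (1 - p)))) (real 1 + 5 / 2)"
  proof (rule trace_norm_asymp[OF p])
    fix n E and i j :: nat
    assume E: "E \<subseteq> all_edges n" and ij: "i < n" "j < n" "i \<noteq> j"
    define e where "e = (1 + of_bool ({i, j} \<in> E) :: real)"
    have e: "0 \<le> e" "e \<le> 2" by (auto simp: e_def)
    have d: "?d E i \<le> real n" "?d E j \<le> real n" using vdegree_le[OF E] ij by auto
    define q where "q = real n * p"
    have np: "0 \<le> q" "q \<le> real n" using p by (auto simp: q_def intro: mult_left_le)
    have "\<bar>HM n E i j - q * q * (e / 2)\<bar> \<le>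
       3 * real n * (\<bar>?d E i - q\<bar> + \<bar>?d E j - q\<bar> + real n * of_bool (codegree n E i j = 0))"
    proof (cases "codegree n E i j = 0")
      case True
      have "HM n E i j = (?d E i * ?d E j) * (1 / real (dist_graph E i j))" using ij by (simp add: HM_def)
      also have "\<dots> \<le> (real n * real n) * 1" using d by (intro mult_mono inverse_nat_le_1) auto
      finally have 1: "HM n E i j \<le> real n * real n" by simp
      have 2: "0 \<le> HM n E i j" by (simp add: HM_def)
      have 3: "0 \<le> q * q * (e / 2)" using np e by simp
      have 4: "q * q * (e / 2) \<le> real n * real n * 1" using np e by (intro mult_mono) auto
      have "\<bar>HM n E i j - q * q * (e / 2)\<bar> \<le> real n * real n" using 1 2 3 4 by (simp add: abs_le_iff)
      also have "\<dots> \<le> 3 * real n * (0 + 0 + real n)" by simp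
      also have "\<dots> \<le> 3 * real n * (\<bar>?d E i - q\<bar> + \<bar>?d E j - q\<bar> + real n)"
        by (intro mult_left_mono add_mono) auto
      finally show ?thesis using True by simp
    next
      case False
      have "HM n E i j = (?d E i * ?d E j) * (1 / real (dist_graph E i j))" using ij by (simp add: HM_def)
      also have "\<dots> = (?d E i * ?d E j) * (e / 2)" unfolding inverse_dist_graph[OF E ij(3) False] e_def ..
      finally have "HM n E i j - q * q * (e / 2) = (e / 2) * (?d E i * (?d E j - q) + q * (?d E i - q))"
        by (simp add: field_simps)
      hence "\<bar>HM n E i j - q * q * (e / 2)\<bar> = \<bar>(e / 2) * (?d E i * (?d E j - q) + q * (?d E i - q))\<bar>"
        by (rule arg_cong)
      also have "\<dots> = (e / 2) * \<bar>?d E i * (?d E j - q) + q * (?d E i - q)\<bar>"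
        unfolding abs_mult using e by simp
      also have "\<dots> \<le> 1 * (\<bar>?d E i * (?d E j - q)\<bar> + \<bar>q * (?d E i - q)\<bar>)"
        using e by (intro mult_mono abs_triangle_ineq) auto
      also have "\<dots> \<le> real n * \<bar>?d E j - q\<bar> + real n * \<bar>?d E i - q\<bar>"
        using d np by (auto simp: abs_mult intro!: add_mono mult_right_mono)
      also have "\<dots> \<le> 3 * real n * (\<bar>?d E i - q\<bar> + \<bar>?d E j - q\<bar>)"
        by (simp add: algebra_simps)
      finally show ?thesis using False by simp
    qed
    moreover have "q * q * (e / 2) = p\<^sup>2 / 2 * real n ^ Suc 1 * (1 + of_bool ({i, j} \<in> E))"
      by (simp add: q_def e_def power2_eq_square)
    ultimately show "\<bar>HM n E i j - p\<^sup>2 / 2 * real n ^ Suc 1 * (1 + of_bool ({i, j} \<in> E))\<bar> \<le>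
       3 * real n ^ 1 * (\<bar>?d E i - real n * p\<bar> + \<bar>?d E j - real n * p\<bar> + real n * of_bool (codegree n E i j = 0))"
      by (simp only: q_def power_one_right)
  next
    have "p\<^sup>2 \<le> 1" using p by (simp add: abs_square_le_1)
    thus "p\<^sup>2 / 2 \<le> 3" by simp
  qed (use p sym in \<open>auto simp: HM_def\<close>)
  thus "gnp_as_asymp p (\<lambda>n E. energy (harary_mult n E)) (4 / (3 * pi) * p ^ 2 * sqrt (p * (1 - p))) (7 / 2)"
    unfolding trace_norm_def HM_def harary_mult_def by (simp add: mult_ac)
qed

end
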